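(* Let $r\ge1$ be an integer. Consider the following parametric family (with parameter $t$) of linear programs in the variables $x=(x_1,\dots,x_{2r})$: $$\text{minimize}\quad x_1+t^{-1}x_2+\sum_{j=1}^{r-1}t^{-(j+1)}(x_{2j+1}+x_{2j+2})$$ subject to $$x_1\le t^2,\qquad x_2\le t,$$ $$x_{2j+1}\le t\,x_{2j-1},\qquad x_{2j+1}\le t\,x_{2j},\qquad x_{2j+2}\le t^{1-1/2^j}(x_{2j-1}+x_{2j})\qquad(1\le j<r),$$ $$x_{2r-1}\ge0,\qquad x_{2r}\ge0,$$ defined by $3r+1$ inequalities in dimension $2r$. The number of linear pieces in the subset of the tropical entropic central path (of this family) with parameter $\mu\in[0,2]$ is equal to $2^{r-1}$.
   Context: Field $\mathbb K$: the field of absolutely convergent generalized real Puiseux series, i.e., series $\boldsymbol z=\sum_{\alpha\in\mathbb R} c_\alpha t^\alpha$ with real coefficients whose support $\{\alpha : c_\alpha\neq 0\}$ is either finite or has $-\infty$ as its unique accumulation point, and which are absolutely convergent for all sufficiently large real $t$. $\boldsymbol z(t)$ denotes the value at such $t$. The valuation $\operatorname{val}\boldsymbol z$ is the greatest element of the support ($-\infty$ if $\boldsymbol z=0$). $\mathbb K_{>0}$ is the set of series whose leading coefficient (that of the greatest exponent) is positive. $\log_t(\cdot)=\log(\cdot)/\log t$, applied entrywise to vectors. For a given parametric family of linear programs, $\boldsymbol{\mathcal P}(t)\subset\mathbb R^n$ denotes the feasible polyhedron and $\boldsymbol c(t)\in\mathbb R^n$ the objective vector for the value $t$ of the parameter (here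 $n=2r$). Entropic central path: for a polyhedron $\mathcal P\subset\mathbb R^n$, let $f_{\mathcal P}(\theta)=\log\int_{\mathcal P}e^{\langle\theta,x\rangle}dx$ and let $f^*_{\mathcal P}$ be its Fenchel conjugate (the entropic barrier). For $c\in\mathbb R^n$ and $\mu>0$, $\mathcal C_{\mathcal P,c}(\mu)$ is the unique optimal solution of: minimize $\langle c,x\rangle+\mu f^*_{\mathcal P}(x)$ subject to $x\in\operatorname{int}\mathcal P$. The tropical entropic central path is the function mapping $\mu\in\mathbb R$ to $\lim_{t\to+\infty}\log_t\mathcal C_{\boldsymbol{\mathcal P}(t),\boldsymbol c(t)}(\boldsymbol\mu(t))\in\mathbb R^n$, where $\boldsymbol\mu\in\mathbb K_{>0}$ is any element with $\operatorname{val}\boldsymbol\mu=\mu$ (for the family considered, this limit exists and depends only on $\operatorname{val}\boldsymbol\mu$, and the function is piecewise linear). The number of linear pieces of a continuous piecewise linear function on an interval is the number of maximal subintervals (with nonempty interior) on which it is affine. *)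

theory Defs
  imports "HOL-Analysis.Analysis"
begin

section \<open>Absolutely convergent generalized real Puiseux series\<close>

text \<open>A series \<open>\<Sum>\<^sub>\<alpha> c\<^sub>\<alpha> t\<^sup>\<alpha>\<close> is represented by its coefficient function \<open>\<alpha> \<mapsto> c\<^sub>\<alpha>\<close>.\<close>

definition puiseux_supp :: "(real \<Rightarrow> real) \<Rightarrow> real set" where
  "puiseux_supp z = {\<alpha>. z \<alpha> \<noteq> 0}"

text \<open>Accumulation points are taken in the extended reals, so that \<open>-\<infinity>\<close> being the only one
  excludes real accumulation points and \<open>+\<infinity>\<close>.\<close>

definition puiseux :: "(real \<Rightarrow> real) set" where
  "puiseux =
    {z. (finite (puiseux_supp z) \<or> {a. a islimpt (ereal ` puiseux_supp z)} = {- \<infinity>}) \<and>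
        (\<forall>\<^sub>F t in at_top. (\<lambda>\<alpha>. \<bar>z \<alpha> * t powr \<alpha>\<bar>) summable_on puiseux_supp z)}"

definition puiseux_eval :: "(real \<Rightarrow> real) \<Rightarrow> real \<Rightarrow> real" where
  "puiseux_eval z t = (\<Sum>\<^sub>\<infinity>\<alpha>\<in>puiseux_supp z. z \<alpha> * t powr \<alpha>)"

definition puiseux_val :: "(real \<Rightarrow> real) \<Rightarrow> ereal" where
  "puiseux_val z =
    (if puiseux_supp z = {} then - \<infinity> else ereal (GREATEST \<alpha>. \<alpha> \<in> puiseux_supp z))"

definition puiseux_pos :: "(real \<Rightarrow> real) set" where
  "puiseux_pos =
    {z \<in> puiseux. puiseux_supp z \<noteq> {} \<and> 0 < z (GREATEST \<alpha>. \<alpha> \<in> puiseux_supp z)}"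


section \<open>The entropic central path\<close>

text \<open>The logarithm of a nonnegative integral, with values \<open>-\<infinity>\<close> at \<open>0\<close> and \<open>\<infinity>\<close> at \<open>\<infinity>\<close>.\<close>

definition ln_ennreal :: "ennreal \<Rightarrow> ereal" where
  "ln_ennreal u =
    (if u = 0 then - \<infinity> else if u = \<infinity> then \<infinity> else ereal (ln (enn2real u)))"

definition log_laplace :: "'a::euclidean_space set \<Rightarrow> 'a \<Rightarrow> ereal" where
  "log_laplace P \<theta> = ln_ennreal (\<integral>\<^sup>+x\<in>P. ennreal (exp (\<theta> \<bullet> x)) \<partial>lborel)"

definition fenchel_conjugate :: "('a::real_inner \<Rightarrow> ereal) \<Rightarrow> 'a \<Rightarrow> ereal" where
  "fenchel_conjugate f x = (SUP \<theta>. ereal (\<theta> \<bullet> x) - f \<theta>)"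

definition entropic_barrier :: "'a::euclidean_space set \<Rightarrow> 'a \<Rightarrow> ereal" where
  "entropic_barrier P = fenchel_conjugate (log_laplace P)"

definition entropic_central_path :: "'a::euclidean_space set \<Rightarrow> 'a \<Rightarrow> real \<Rightarrow> 'a" where
  "entropic_central_path P c \<mu> =
    (THE x. is_arg_min (\<lambda>x. ereal (c \<bullet> x) + ereal \<mu> * entropic_barrier P x)
                       (\<lambda>x. x \<in> interior P) x)"

definition log_vec :: "real \<Rightarrow> real ^ 'n \<Rightarrow> real ^ 'n" where
  "log_vec t x = (\<chi> i. log t (x $ i))"

definition is_tropical_central_point ::
    "(real \<Rightarrow> (real ^ 'n) set) \<Rightarrow> (real \<Rightarrow> real ^ 'n) \<Rightarrow> real \<Rightarrow> real ^ 'n \<Rightarrow> bool" where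
  "is_tropical_central_point P c \<mu> y \<longleftrightarrow>
    (\<forall>m\<in>puiseux_pos. puiseux_val m = ereal \<mu> \<longrightarrow>
      ((\<lambda>t. log_vec t (entropic_central_path (P t) (c t) (puiseux_eval m t))) \<longlongrightarrow> y) at_top)"

definition tropical_entropic_central_path ::
    "(real \<Rightarrow> (real ^ 'n) set) \<Rightarrow> (real \<Rightarrow> real ^ 'n) \<Rightarrow> real \<Rightarrow> real ^ 'n" where
  "tropical_entropic_central_path P c \<mu> = (THE y. is_tropical_central_point P c \<mu> y)"


section \<open>Linear pieces\<close>

definition affine_on :: "real set \<Rightarrow> (real \<Rightarrow> 'a::real_vector) \<Rightarrow> bool" where
  "affine_on J f \<longleftrightarrow> (\<exists>a b. \<forall>x\<in>J. f x = a + x *\<^sub>R b)"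

definition piecewise_linear_on :: "real set \<Rightarrow> (real \<Rightarrow> 'a::real_vector) \<Rightarrow> bool" where
  "piecewise_linear_on I f \<longleftrightarrow>
    (\<exists>\<J>. finite \<J> \<and> \<Union>\<J> = I \<and> (\<forall>J\<in>\<J>. is_interval J \<and> affine_on J f))"

definition affinity_intervals ::
    "real set \<Rightarrow> (real \<Rightarrow> 'a::real_vector) \<Rightarrow> real set set" where
  "affinity_intervals I f =
    {J. J \<subseteq> I \<and> is_interval J \<and> interior J \<noteq> {} \<and> affine_on J f}"

definition linear_pieces :: "real set \<Rightarrow> (real \<Rightarrow> 'a::real_vector) \<Rightarrow> real set set" where
  "linear_pieces I f =
    {J \<in> affinity_intervals I f. \<forall>K\<in>affinity_intervals I f. J \<subseteq> K \<longrightarrow> K = J}"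


section \<open>The parametric family of linear programs\<close>

text \<open>The variables \<open>x\<^sub>1, \<dots>, x\<^sub>2\<^sub>r\<close> are the coordinates of a vector in \<open>real ^ 'n\<close> for an index
  type of cardinality \<open>2r\<close>; the enumeration \<open>ix\<close> of the index type by \<open>1, \<dots>, 2r\<close> makes
  \<open>x $ ix k\<close> the variable \<open>x\<^sub>k\<close>.\<close>

definition lp_feasible :: "nat \<Rightarrow> (nat \<Rightarrow> 'n) \<Rightarrow> real \<Rightarrow> (real ^ 'n) set" where
  "lp_feasible r ix t =
    {x. x $ ix 1 \<le> t ^ 2 \<and> x $ ix 2 \<le> t \<and>
        (\<forall>j\<in>{1..<r}.
           x $ ix (2*j + 1) \<le> t * x $ ix (2*j - 1) \<and>
           x $ ix (2*j + 1) \<le> t * x $ ix (2*j) \<and>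
           x $ ix (2*j + 2) \<le> t powr (1 - 1 / 2 ^ j) * (x $ ix (2*j - 1) + x $ ix (2*j))) \<and>
        0 \<le> x $ ix (2*r - 1) \<and> 0 \<le> x $ ix (2*r)}"

definition lp_objective :: "nat \<Rightarrow> (nat \<Rightarrow> 'n) \<Rightarrow> real \<Rightarrow> real ^ 'n" where
  "lp_objective r ix t =
    axis (ix 1) 1 + (1 / t) *\<^sub>R axis (ix 2) 1 +
    (\<Sum>j = 1..<r. (1 / t ^ (j + 1)) *\<^sub>R (axis (ix (2*j + 1)) 1 + axis (ix (2*j + 2)) 1))"

lemma lp_objective_inner:
  fixes x :: "real ^ 'n"
  shows "lp_objective r ix t \<bullet> x =
    x $ ix 1 + (1 / t) * x $ ix 2 +
    (\<Sum>j = 1..<r. (1 / t ^ (j + 1)) * (x $ ix (2*j + 1) + x $ ix (2*j + 2)))"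
  by (simp add: lp_objective_def inner_add_left inner_sum_left inner_axis')

end

theory Submission
  imports Defs
begin

text \<open>
  The entropic central path is a curve of means. For a convex body \<open>P\<close> the function
  \<open>f(\<theta>) = log \<integral>\<^sub>P exp(\<theta> \<bullet> x) dx\<close> is differentiable, its gradient is the mean of the Gibbs
  distribution with density proportional to \<open>exp(\<theta> \<bullet> x)\<close> on \<open>P\<close>, and by Fenchel duality the point
  of the path with parameter \<open>\<mu>\<close> is this mean at \<open>\<theta> = - c / \<mu>\<close>
  (\<open>entropic_central_path_eq_gibbs_mean\<close>).

  The mean of a Gibbs distribution on a polytope that contains \<open>0\<close>, if the variables and the
  objective are nonnegative on it, can be found up to constant factors (\<open>gibbs_mean_bounds\<close>). By a scaling argument the expectation of
  \<open>c \<bullet> x / \<mu>\<close> is bounded by a constant that depends on the dimension only, so at least half of the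
  mass lies in the truncation \<open>{x \<in> P. c \<bullet> x \<le> L \<mu>}\<close> for some such constant \<open>L\<close>. If the truncation
  fits into the box \<open>[0, K a]\<close>, and if \<open>P\<close> contains a box whose sides are comparable to the entries
  of \<open>a\<close>, then the mean is comparable to \<open>a\<close> entry by entry.

  For the family at hand such an \<open>a\<close> is obtained by solving the constraints greedily, each variable
  being taken as large as the previous ones permit, with sums replaced by maxima (\<open>lp_scale\<close>,
  \<open>lp_central_path_bounds\<close>). Constants vanish under \<open>log\<^sub>t\<close>, which turns the greedy recursion into
  its tropical counterpart (\<open>trop_level\<close>): the pair \<open>(u\<^sub>j, v\<^sub>j)\<close> of the coordinates \<open>2j+1\<close> and
  \<open>2j+2\<close> of the tropical path satisfies
  \<open>u\<^sub>0 = \<mu>\<close>, \<open>v\<^sub>0 = 1\<close>, \<open>u\<^sub>j\<^sub>+\<^sub>1 = 1 + min u\<^sub>j v\<^sub>j\<close> and \<open>v\<^sub>j\<^sub>+\<^sub>1 = 1 - 2\<^sup>-\<^sup>j\<^sup>-\<^sup>1 + max u\<^sub>j v\<^sub>j\<close>.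

  Hence the difference \<open>d\<^sub>j = u\<^sub>j - v\<^sub>j\<close> obeys \<open>d\<^sub>j\<^sub>+\<^sub>1 = 2\<^sup>-\<^sup>j\<^sup>-\<^sup>1 - \<bar>d\<^sub>j\<bar>\<close> with \<open>d\<^sub>0 = \<mu> - 1\<close>: it is a zigzag
  with slopes \<open>\<plusminus>1\<close> that has one zero in the middle of each of the \<open>2\<^sup>j\<close> cells into which \<open>[0, 2]\<close>
  is divided, and each zero becomes a kink of the next level. At every \<open>\<mu>\<close> off the grid one of
  \<open>u\<^sub>j, v\<^sub>j\<close> has slope \<open>1\<close> and the other has slope \<open>0\<close>, and the roles are exchanged from each cell
  to the next. So the \<open>2\<^sup>r\<^sup>-\<^sup>1\<close> cells of the last level, \<open>j = r - 1\<close>, are the linear pieces.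
\<close>

section \<open>The entropic central path as a curve of Gibbs means\<close>

definition gibbs_integral ::
    "'a::euclidean_space set \<Rightarrow> 'a \<Rightarrow> ('a \<Rightarrow> 'b::{banach, second_countable_topology}) \<Rightarrow> 'b" where
  "gibbs_integral P \<theta> f = (LINT x:P|lborel. exp (\<theta> \<bullet> x) *\<^sub>R f x)"

definition gibbs_mean :: "'a::euclidean_space set \<Rightarrow> 'a \<Rightarrow> 'a" where
  "gibbs_mean P \<theta> = gibbs_integral P \<theta> (\<lambda>x. x) /\<^sub>R gibbs_integral P \<theta> (\<lambda>_. 1 :: real)"

lemma set_integrable_gibbs:
  fixes f :: "'a::euclidean_space \<Rightarrow> 'b::{banach, second_countable_topology}"
  assumes "compact P" "continuous_on P f"
  shows "set_integrable lborel P (\<lambda>x. exp (\<theta> \<bullet> x) *\<^sub>R f x)"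
  unfolding set_integrable_def
  by (intro borel_integrable_compact continuous_intros assms)

lemma gibbs_integral_mono:
  fixes f g :: "'a::euclidean_space \<Rightarrow> real"
  assumes "compact P" "continuous_on P f" "continuous_on P g" "\<And>x. x \<in> P \<Longrightarrow> f x \<le> g x"
  shows "gibbs_integral P \<theta> f \<le> gibbs_integral P \<theta> g"
  unfolding gibbs_integral_def
  by (intro set_integral_mono set_integrable_gibbs assms) (simp add: assms)

lemma gibbs_integral_add:
  assumes "compact P" "continuous_on P f" "continuous_on P g"
  shows "gibbs_integral P \<theta> (\<lambda>x. f x + g x) = gibbs_integral P \<theta> f + gibbs_integral P \<theta> g"
  unfolding gibbs_integral_def scaleR_add_right
  by (intro set_integral_add set_integrable_gibbs assms)

lemma gibbs_integral_diff:
  assumes "compact P" "continuous_on P f" "continuous_on P g"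
  shows "gibbs_integral P \<theta> (\<lambda>x. f x - g x) = gibbs_integral P \<theta> f - gibbs_integral P \<theta> g"
  unfolding gibbs_integral_def scaleR_diff_right
  by (intro set_integral_diff set_integrable_gibbs assms)

lemma gibbs_integral_cmult:
  fixes f :: "'a::euclidean_space \<Rightarrow> real"
  shows "gibbs_integral P \<theta> (\<lambda>x. c * f x) = c * gibbs_integral P \<theta> f"
  unfolding gibbs_integral_def real_scaleR_def mult.left_commute[of _ c] by simp

lemma gibbs_integral_const:
  "gibbs_integral P \<theta> (\<lambda>_. c :: real) = c * gibbs_integral P \<theta> (\<lambda>_. 1)"
  using gibbs_integral_cmult[of P \<theta> c "\<lambda>_. 1"] by simp

lemma gibbs_integral_inner:
  assumes "compact P"
  shows "d \<bullet> gibbs_integral P \<theta> (\<lambda>x. x) = gibbs_integral P \<theta> (\<lambda>x. d \<bullet> x)"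
proof -
  have "integrable lborel (\<lambda>x. indicator P x *\<^sub>R exp (\<theta> \<bullet> x) *\<^sub>R x)"
    using set_integrable_gibbs[OF assms, of "\<lambda>x. x" \<theta>] by (simp add: set_integrable_def)
  then show ?thesis
    by (simp add: gibbs_integral_def set_lebesgue_integral_def mult.assoc flip: integral_inner_right)
qed

text \<open>With integral zero, \<open>f\<close> would vanish almost everywhere on the interior of \<open>P\<close>, a nonempty open
  set, which is not negligible.\<close>

lemma gibbs_integral_pos:
  fixes f :: "'a::euclidean_space \<Rightarrow> real"
  assumes P: "compact P" "interior P \<noteq> {}" and f: "continuous_on P f" "\<And>x. x \<in> P \<Longrightarrow> 0 \<le> f x"
    and null: "negligible {x. f x = 0}"
  shows "0 < gibbs_integral P \<theta> f"
proof -
  let ?g = "\<lambda>x. indicator P x *\<^sub>R (exp (\<theta> \<bullet> x) *\<^sub>R f x)"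
  have int: "integrable lborel ?g"
    using set_integrable_gibbs[OF P(1) f(1)] by (simp add: set_integrable_def)
  have nonneg: "AE x in lborel. 0 \<le> ?g x"
    using f(2) by (simp add: indicator_def)
  have "integral\<^sup>L lborel ?g \<noteq> 0"
  proof
    assume "integral\<^sup>L lborel ?g = 0"
    then have "AE x in lborel. ?g x = 0"
      using integral_nonneg_eq_0_iff_AE[OF int nonneg] by simp
    then have "AE x in lebesgue. ?g x = 0"
      by (rule AE_completion)
    moreover have "AE x in lebesgue. x \<notin> {x. f x = 0}"
      using null by (intro AE_not_in) (simp add: negligible_iff_null_sets)
    ultimately have "AE x in lebesgue. x \<notin> interior P"
      by eventually_elim (use interior_subset[of P] in \<open>auto simp: indicator_def split: if_splits\<close>)
    then have "interior P \<in> null_sets lebesgue"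
      by (subst AE_iff_null_sets) auto
    then have "negligible (interior P)"
      by (simp add: negligible_iff_null_sets)
    with P(2) show False
      using open_not_negligible[of "interior P"] by simp
  qed
  moreover have "0 \<le> integral\<^sup>L lborel ?g"
    by (rule integral_nonneg_AE[OF nonneg])
  ultimately show ?thesis
    by (simp add: gibbs_integral_def set_lebesgue_integral_def)
qed

corollary gibbs_partition_pos:
  assumes "compact P" "interior P \<noteq> {}"
  shows "0 < gibbs_integral P \<theta> (\<lambda>_. 1 :: real)"
  using assms by (intro gibbs_integral_pos) auto

lemma inner_gibbs_mean:
  assumes "compact P"
  shows "d \<bullet> gibbs_mean P \<theta> =
    gibbs_integral P \<theta> (\<lambda>x. d \<bullet> x) / gibbs_integral P \<theta> (\<lambda>_. 1 :: real)"
  by (simp add: gibbs_mean_def gibbs_integral_inner[OF assms] divide_inverse mult.commute)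

text \<open>Otherwise some linear functional \<open>x \<mapsto> a \<bullet> x\<close> attains its maximum over \<open>P\<close> at the mean, so
  that it deviates from its mean value in one direction only; it is not constant on \<open>P\<close>, and this
  contradicts the definition of the mean.\<close>

lemma gibbs_mean_in_interior:
  assumes "compact P" "convex P" "interior P \<noteq> {}"
  shows "gibbs_mean P \<theta> \<in> interior P"
proof (rule ccontr)
  let ?m = "gibbs_mean P \<theta>" and ?Z = "gibbs_integral P \<theta> (\<lambda>_. 1 :: real)"
  assume "?m \<notin> interior P"
  then obtain a b where a: "a \<noteq> 0" and le: "\<And>x. x \<in> interior P \<Longrightarrow> a \<bullet> x \<le> b" and b: "b \<le> a \<bullet> ?m"
    using separating_hyperplane_sets[of "interior P" "{?m}"] assms
    by (auto simp: convex_interior)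
  have "closure (interior P) \<subseteq> {x. a \<bullet> x \<le> a \<bullet> ?m}"
    using le b by (intro closure_minimal closed_halfspace_le) force
  moreover have "P \<subseteq> closure (interior P)"
    using convex_closure_interior[OF assms(2,3)] closure_subset by simp
  ultimately have "0 < gibbs_integral P \<theta> (\<lambda>x. a \<bullet> ?m - a \<bullet> x)"
    using a assms by (intro gibbs_integral_pos negligible_subset[OF negligible_hyperplane[of a "a \<bullet> ?m"]])
      (auto intro!: continuous_intros)
  also have "\<dots> = a \<bullet> ?m * ?Z - gibbs_integral P \<theta> (\<lambda>x. a \<bullet> x)"
    using assms by (subst gibbs_integral_diff) (auto intro!: continuous_intros simp: gibbs_integral_const[of P \<theta> "a \<bullet> ?m"])
  also have "\<dots> = 0"
    using gibbs_partition_pos[OF assms(1,3), of \<theta>] by (simp add: inner_gibbs_mean[OF assms(1)])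
  finally show False by simp
qed

lemma log_laplace_eq_ln:
  assumes "compact P" "interior P \<noteq> {}"
  shows "log_laplace P \<theta> = ereal (ln (gibbs_integral P \<theta> (\<lambda>_. 1)))"
proof -
  let ?g = "\<lambda>x. indicator P x *\<^sub>R (exp (\<theta> \<bullet> x) *\<^sub>R (1::real))"
  have int: "integrable lborel ?g"
    using set_integrable_gibbs[OF assms(1), of "\<lambda>_. 1 :: real" \<theta>] by (simp add: set_integrable_def)
  have "(\<integral>\<^sup>+x\<in>P. ennreal (exp (\<theta> \<bullet> x)) \<partial>lborel) = (\<integral>\<^sup>+x. ennreal (?g x) \<partial>lborel)"
    by (intro nn_integral_cong) (simp add: indicator_def)
  also have "\<dots> = ennreal (gibbs_integral P \<theta> (\<lambda>_. 1))"
    using nn_integral_eq_integral[OF int] by (simp add: gibbs_integral_def set_lebesgue_integral_def)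
  finally show ?thesis
    using gibbs_partition_pos[OF assms, of \<theta>] by (simp add: log_laplace_def ln_ennreal_def)
qed

text \<open>The mean is a subgradient of the log-partition function: this is Jensen's inequality
  \<open>exp (E[d \<bullet> x]) \<le> E[exp (d \<bullet> x)]\<close>.\<close>

lemma log_partition_ge_mean:
  assumes "compact P" "interior P \<noteq> {}"
  shows "ln (gibbs_integral P \<theta> (\<lambda>_. 1)) + d \<bullet> gibbs_mean P \<theta> \<le> ln (gibbs_integral P (\<theta> + d) (\<lambda>_. 1 :: real))"
proof -
  let ?Z = "\<lambda>\<theta>. gibbs_integral P \<theta> (\<lambda>_. 1 :: real)" and ?m = "gibbs_mean P \<theta>"
  note Z = gibbs_partition_pos[OF assms]
  have "?Z \<theta> = (1 - d \<bullet> ?m) * ?Z \<theta> + gibbs_integral P \<theta> (\<lambda>x. d \<bullet> x)"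
    using Z[of \<theta>] by (simp add: inner_gibbs_mean[OF assms(1)] field_simps)
  also have "\<dots> = gibbs_integral P \<theta> (\<lambda>x. (1 - d \<bullet> ?m) + d \<bullet> x)"
    using assms by (subst gibbs_integral_add)
      (auto intro!: continuous_intros simp: gibbs_integral_const[of P \<theta> "1 - d \<bullet> ?m"])
  also have "\<dots> \<le> gibbs_integral P \<theta> (\<lambda>x. exp (- (d \<bullet> ?m)) * exp (d \<bullet> x))"
  proof (intro gibbs_integral_mono assms continuous_intros)
    fix x
    show "1 - d \<bullet> ?m + d \<bullet> x \<le> exp (- (d \<bullet> ?m)) * exp (d \<bullet> x)"
      using exp_ge_add_one_self[of "- (d \<bullet> ?m) + d \<bullet> x"] unfolding exp_add by simp
  qed
  also have "\<dots> = exp (- (d \<bullet> ?m)) * ?Z (\<theta> + d)"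
    by (simp add: gibbs_integral_cmult gibbs_integral_def inner_add_left exp_add)
  finally have "ln (?Z \<theta>) \<le> ln (exp (- (d \<bullet> ?m)) * ?Z (\<theta> + d))"
    using Z by (subst ln_le_cancel_iff) auto
  then show ?thesis
    using Z[of "\<theta> + d"] by (simp add: ln_mult)
qed

text \<open>A second-order upper bound that is enough to differentiate under the integral sign at a point.\<close>

lemma exp_le_quadratic:
  fixes u :: real
  assumes "u \<le> 1 / 2"
  shows "exp u \<le> 1 + u + 2 * u\<^sup>2"
proof -
  have "0 \<le> u\<^sup>2 * (1 - 2 * u)"
    using assms by simp
  then have "1 \<le> (1 - u) * (1 + u + 2 * u\<^sup>2)"
    by (simp add: power2_eq_square algebra_simps)
  also have "\<dots> \<le> exp (- u) * (1 + u + 2 * u\<^sup>2)"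
  proof (rule mult_right_mono)
    show "1 - u \<le> exp (- u)"
      using exp_ge_add_one_self[of "- u"] by simp
    have "0 \<le> (u + 1 / 2)\<^sup>2 + u\<^sup>2 + 3 / 4"
      by simp
    then show "0 \<le> 1 + u + 2 * u\<^sup>2"
      by (simp add: power2_eq_square algebra_simps)
  qed
  finally show ?thesis
    by (simp add: exp_minus field_simps)
qed

text \<open>The log-partition function is differentiable with the mean as gradient. Because \<open>P\<close> is bounded,
  the logarithm of \<open>E[exp (s (d \<bullet> x))]\<close> exceeds \<open>s\<close> times the mean of \<open>d \<bullet> x\<close> by \<open>O(s\<^sup>2)\<close> only, so
  that letting \<open>s\<close> tend to \<open>0\<close> from above compares any subgradient with the mean in every
  direction \<open>d\<close>.\<close>

lemma log_partition_subgradient_unique: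
  assumes "compact P" "interior P \<noteq> {}"
    and sub: "\<And>d. ln (gibbs_integral P \<theta> (\<lambda>_. 1)) + d \<bullet> x \<le> ln (gibbs_integral P (\<theta> + d) (\<lambda>_. 1 :: real))"
  shows "x = gibbs_mean P \<theta>"
proof -
  let ?Z = "\<lambda>\<theta>. gibbs_integral P \<theta> (\<lambda>_. 1 :: real)" and ?m = "gibbs_mean P \<theta>"
  note Z = gibbs_partition_pos[OF assms(1,2)]
  have "d \<bullet> x \<le> d \<bullet> ?m" for d
  proof -
    obtain R where R: "R > 0" "\<And>y. y \<in> P \<Longrightarrow> \<bar>d \<bullet> y\<bar> \<le> R"
    proof -
      have "compact ((\<lambda>y. d \<bullet> y) ` P)"
        by (intro compact_continuous_image continuous_intros assms)
      then obtain b where "b > 0" "\<forall>y\<in>(\<lambda>y. d \<bullet> y) ` P. norm y \<le> b"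
        using compact_imp_bounded bounded_pos by blast
      then show ?thesis using that[of b] by auto
    qed
    have quad: "s * (d \<bullet> x) \<le> s * (d \<bullet> ?m) + 2 * (s * R)\<^sup>2" if s: "0 < s" "s * R \<le> 1 / 2" for s
    proof -
      have "?Z (\<theta> + s *\<^sub>R d) = gibbs_integral P \<theta> (\<lambda>y. exp (s * (d \<bullet> y)))"
        by (simp add: gibbs_integral_def inner_add_left exp_add)
      also have "\<dots> \<le> gibbs_integral P \<theta> (\<lambda>y. (1 + 2 * (s * R)\<^sup>2) + s * (d \<bullet> y))"
      proof (intro gibbs_integral_mono assms continuous_intros)
        fix y assume "y \<in> P"
        then have *: "\<bar>s * (d \<bullet> y)\<bar> \<le> s * R"
          using R s by (simp add: abs_mult)
        then have "exp (s * (d \<bullet> y)) \<le> 1 + s * (d \<bullet> y) + 2 * (s * (d \<bullet> y))\<^sup>2"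
          using s by (intro exp_le_quadratic) linarith
        also have "(s * (d \<bullet> y))\<^sup>2 \<le> (s * R)\<^sup>2"
          using * by (rule power2_le_iff_abs_le[THEN iffD2, rotated]) (use s R in auto)
        finally show "exp (s * (d \<bullet> y)) \<le> (1 + 2 * (s * R)\<^sup>2) + s * (d \<bullet> y)"
          by simp
      qed
      also have "\<dots> = (1 + 2 * (s * R)\<^sup>2) * ?Z \<theta> + s * gibbs_integral P \<theta> (\<lambda>y. d \<bullet> y)"
        using assms by (subst gibbs_integral_add)
          (auto intro!: continuous_intros simp: gibbs_integral_const[of P \<theta> "1 + 2 * (s * R)\<^sup>2"] gibbs_integral_cmult)
      also have "\<dots> = (1 + (s * (d \<bullet> ?m) + 2 * (s * R)\<^sup>2)) * ?Z \<theta>"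
        using Z[of \<theta>] by (simp add: inner_gibbs_mean[OF assms(1)] field_simps)
      also have "\<dots> \<le> exp (s * (d \<bullet> ?m) + 2 * (s * R)\<^sup>2) * ?Z \<theta>"
        using Z[of \<theta>] by (intro mult_right_mono exp_ge_add_one_self) auto
      finally have "ln (?Z (\<theta> + s *\<^sub>R d)) \<le> ln (exp (s * (d \<bullet> ?m) + 2 * (s * R)\<^sup>2) * ?Z \<theta>)"
        using Z by (subst ln_le_cancel_iff) auto
      also have "\<dots> = (s * (d \<bullet> ?m) + 2 * (s * R)\<^sup>2) + ln (?Z \<theta>)"
        using Z[of \<theta>] by (simp add: ln_mult)
      finally show ?thesis
        using sub[of "s *\<^sub>R d"] by simp
    qed
    have "d \<bullet> x \<le> d \<bullet> ?m + 2 * s * R\<^sup>2" if "0 < s" "s * R \<le> 1 / 2" for s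
    proof -
      have "s * (d \<bullet> x) \<le> s * (d \<bullet> ?m + 2 * s * R\<^sup>2)"
        using quad[OF that] by (simp add: power2_eq_square algebra_simps)
      then show ?thesis using that(1) by simp
    qed
    then have "\<forall>\<^sub>F s in at_right 0. d \<bullet> x \<le> d \<bullet> ?m + 2 * s * R\<^sup>2"
      using R(1) by (intro eventually_at_rightI[of 0 "1 / (2 * R)"]) (auto simp: field_simps)
    moreover have "((\<lambda>s. d \<bullet> ?m + 2 * s * R\<^sup>2) \<longlongrightarrow> d \<bullet> ?m + 2 * 0 * R\<^sup>2) (at_right 0)"
      by (intro tendsto_intros)
    ultimately have "d \<bullet> x \<le> d \<bullet> ?m + 2 * 0 * R\<^sup>2"
      by (intro tendsto_lowerbound[OF _ _ trivial_limit_at_right_real])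
    then show ?thesis by simp
  qed
  from this[of "x - ?m"] have "(x - ?m) \<bullet> (x - ?m) \<le> 0"
    by (simp add: inner_diff_right)
  then show ?thesis
    using inner_gt_zero_iff[of "x - ?m"] by (auto simp: not_less[symmetric])
qed

text \<open>With \<open>\<theta> = - c / \<mu>\<close> and \<open>f\<close> the log-partition function, the objective is
  \<open>\<mu> (f\<^sup>*(x) - \<theta> \<bullet> x)\<close>. By Fenchel's inequality it is at least \<open>- \<mu> f(\<theta>)\<close>, and equality holds
  exactly when \<open>x\<close> is a subgradient of \<open>f\<close> at \<open>\<theta>\<close>, that is, when \<open>x\<close> is the mean.\<close>

theorem entropic_central_path_eq_gibbs_mean:
  assumes P: "compact P" "convex P" "interior P \<noteq> {}" and \<mu>: "0 < \<mu>"
  shows "entropic_central_path P c \<mu> = gibbs_mean P (- (c /\<^sub>R \<mu>))"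
proof -
  let ?L = "\<lambda>\<theta>. ln (gibbs_integral P \<theta> (\<lambda>_. 1 :: real))" and ?\<theta> = "- (c /\<^sub>R \<mu>)"
  let ?m = "gibbs_mean P ?\<theta>" and ?F = "\<lambda>x. ereal (c \<bullet> x) + ereal \<mu> * entropic_barrier P x"
  have c: "c \<bullet> x = - \<mu> * (?\<theta> \<bullet> x)" for x
    using \<mu> by simp
  have conj: "entropic_barrier P x = (SUP \<theta>. ereal (\<theta> \<bullet> x - ?L \<theta>))" for x
    using P by (simp add: entropic_barrier_def fenchel_conjugate_def log_laplace_eq_ln)
  have F_le_iff: "?F x \<le> ereal (- \<mu> * ?L ?\<theta>) \<longleftrightarrow> (\<forall>d. ?L ?\<theta> + d \<bullet> x \<le> ?L (?\<theta> + d))" for x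
  proof -
    have "?F x \<le> ereal (- \<mu> * ?L ?\<theta>) \<longleftrightarrow> entropic_barrier P x \<le> ereal (?\<theta> \<bullet> x - ?L ?\<theta>)"
      using \<mu> unfolding c by (cases "entropic_barrier P x") (auto simp: field_simps)
    also have "\<dots> \<longleftrightarrow> (\<forall>\<theta>. \<theta> \<bullet> x - ?L \<theta> \<le> ?\<theta> \<bullet> x - ?L ?\<theta>)"
      by (simp add: conj SUP_le_iff)
    also have "\<dots> \<longleftrightarrow> (\<forall>d. (?\<theta> + d) \<bullet> x - ?L (?\<theta> + d) \<le> ?\<theta> \<bullet> x - ?L ?\<theta>)"
      by (metis add.commute diff_add_cancel)
    finally show ?thesis
      by (simp add: inner_add_left algebra_simps)
  qed
  have F_ge: "ereal (- \<mu> * ?L ?\<theta>) \<le> ?F x" for x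
  proof -
    have "ereal (?\<theta> \<bullet> x - ?L ?\<theta>) \<le> entropic_barrier P x"
      unfolding conj by (rule SUP_upper) simp
    then show ?thesis
      using \<mu> unfolding c by (cases "entropic_barrier P x") (auto simp: field_simps)
  qed
  have F_m: "?F ?m \<le> ereal (- \<mu> * ?L ?\<theta>)"
    unfolding F_le_iff using log_partition_ge_mean[OF P(1,3)] by blast
  have "is_arg_min ?F (\<lambda>x. x \<in> interior P) x \<longleftrightarrow> x = ?m" for x
  proof
    assume "is_arg_min ?F (\<lambda>x. x \<in> interior P) x"
    then have "?F x \<le> ?F ?m"
      using gibbs_mean_in_interior[OF P] by (auto simp: is_arg_min_def not_less)
    then have "\<forall>d. ?L ?\<theta> + d \<bullet> x \<le> ?L (?\<theta> + d)"
      using F_m F_le_iff by (meson order_trans)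
    then show "x = ?m"
      using log_partition_subgradient_unique[OF P(1,3)] by blast
  next
    assume x: "x = ?m"
    have "?F ?m \<le> ?F y" for y
      using F_m F_ge by (rule order_trans)
    then show "is_arg_min ?F (\<lambda>x. x \<in> interior P) x"
      unfolding x is_arg_min_def using gibbs_mean_in_interior[OF P] by (auto simp: not_less)
  qed
  then show ?thesis
    by (simp add: entropic_central_path_def)
qed

section \<open>Two-sided bounds for Gibbs means\<close>

text \<open>The integral on the left is \<open>\<integral>\<^sub>P exp(\<theta> \<bullet> x / 2) dx\<close>. The substitution \<open>x = 2 y\<close> restores
  the full exponent at the price of the factor \<open>2\<^sup>n\<close>, and moves the domain to \<open>P / 2\<close>, which
  is contained in \<open>P\<close> because \<open>P\<close> is convex and contains \<open>0\<close>.\<close>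

lemma gibbs_integral_halved_exponent_le:
  fixes P :: "'a::euclidean_space set"
  assumes P: "compact P" "convex P" "0 \<in> P"
  shows "gibbs_integral P \<theta> (\<lambda>x. exp (- (\<theta> \<bullet> x) / 2)) \<le> 2 ^ DIM('a) * gibbs_integral P \<theta> (\<lambda>_. 1 :: real)"
proof -
  let ?g = "\<lambda>x. indicator P x * exp (\<theta> \<bullet> x / 2)" and ?h = "\<lambda>x. indicator P x * exp (\<theta> \<bullet> x)"
  have [measurable]: "P \<in> sets borel"
    using P(1) by (simp add: compact_imp_closed borel_closed)
  have int_h: "integrable lborel ?h"
    using set_integrable_gibbs[OF P(1), of "\<lambda>_. 1 :: real" \<theta>] by (simp add: set_integrable_def)
  have "gibbs_integral P \<theta> (\<lambda>x. exp (- (\<theta> \<bullet> x) / 2)) = integral\<^sup>L lborel ?g"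
    by (simp add: gibbs_integral_def set_lebesgue_integral_def flip: exp_add)
  also have "\<dots> = integral\<^sup>L (density (distr lborel borel (\<lambda>x. 2 *\<^sub>R x)) (\<lambda>_. ennreal (2 ^ DIM('a)))) ?g"
    using arg_cong[OF lborel_affine[of 2 "0 :: 'a"], of "\<lambda>M. integral\<^sup>L M ?g"]
      ennreal_power[of 2 "DIM('a)"] by simp
  also have "\<dots> = 2 ^ DIM('a) * (LINT x|lborel. ?g (2 *\<^sub>R x))"
    by (subst integral_density) (simp_all add: integral_distr)
  also have "\<dots> \<le> 2 ^ DIM('a) * integral\<^sup>L lborel ?h"
  proof (intro mult_left_mono integral_mono_AE' int_h AE_I2)
    fix x :: 'a
    have "x \<in> P" if "2 *\<^sub>R x \<in> P"
      using convexD_alt[OF P(2) P(3) that, of "1 / 2"] by simp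
    then show "?g (2 *\<^sub>R x) \<le> ?h x"
      by (auto simp: indicator_def)
  qed auto
  also have "integral\<^sup>L lborel ?h = gibbs_integral P \<theta> (\<lambda>_. 1 :: real)"
    by (simp add: gibbs_integral_def set_lebesgue_integral_def)
  finally show ?thesis .
qed

text \<open>For \<open>\<theta> = - c / \<mu>\<close> this bounds the objective on the central path by a multiple of \<open>\<mu>\<close> that
  depends on the dimension only: by \<open>u \<le> exp u\<close>, the mean of \<open>- (\<theta> \<bullet> x) / 2\<close> is at most the mean
  of its exponential.\<close>

lemma gibbs_mean_objective_le:
  fixes P :: "'a::euclidean_space set"
  assumes P: "compact P" "convex P" "interior P \<noteq> {}" "0 \<in> P"
  shows "- (\<theta> \<bullet> gibbs_mean P \<theta>) \<le> 2 ^ (DIM('a) + 1)"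
proof -
  let ?Z = "gibbs_integral P \<theta> (\<lambda>_. 1 :: real)"
  have "- (\<theta> \<bullet> gibbs_mean P \<theta>) = 2 * gibbs_integral P \<theta> (\<lambda>x. (- 1 / 2) * (\<theta> \<bullet> x)) / ?Z"
    unfolding gibbs_integral_cmult by (simp add: inner_gibbs_mean[OF P(1)])
  also have "gibbs_integral P \<theta> (\<lambda>x. (- 1 / 2) * (\<theta> \<bullet> x)) \<le> gibbs_integral P \<theta> (\<lambda>x. exp (- (\<theta> \<bullet> x) / 2))"
  proof (intro gibbs_integral_mono P continuous_intros)
    fix x show "(- 1 / 2) * (\<theta> \<bullet> x) \<le> exp (- (\<theta> \<bullet> x) / 2)"
      using exp_ge_add_one_self[of "- (\<theta> \<bullet> x) / 2"] by simp
  qed auto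
  also have "\<dots> \<le> 2 ^ DIM('a) * ?Z"
    by (rule gibbs_integral_halved_exponent_le[OF P(1,2,4)])
  finally show ?thesis
    using gibbs_partition_pos[OF P(1,3), of \<theta>] by (simp add: divide_right_mono)
qed

text \<open>The upper bound holds because the mean lies in the truncation
  \<open>{x \<in> P. - (\<theta> \<bullet> x) \<le> 2\<^sup>n\<^sup>+\<^sup>2}\<close>. For the lower bound, the box \<open>[l, 2 l]\<close> has probability bounded
  below: its unnormalised density is at least \<open>exp (- D)\<close>, its volume is at least \<open>\<kappa>\<^sup>n \<Prod> a\<^sub>i\<close>, and the
  partition function is at most twice the volume \<open>K\<^sup>n \<Prod> a\<^sub>i\<close> of a box around the truncation.\<close>

theorem gibbs_mean_bounds:
  fixes P :: "(real ^ 'n) set" and a l :: "real ^ 'n"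
  assumes P: "compact P" "convex P" "0 \<in> P"
    and nonneg: "\<And>x. x \<in> P \<Longrightarrow> \<theta> \<bullet> x \<le> 0" "\<And>x i. x \<in> P \<Longrightarrow> 0 \<le> x $ i"
    and upper: "\<And>x i. x \<in> P \<Longrightarrow> - (\<theta> \<bullet> x) \<le> 2 ^ (CARD('n) + 2) \<Longrightarrow> x $ i \<le> K * a $ i"
    and lower: "cbox l (2 *\<^sub>R l) \<subseteq> P" "\<And>x. x \<in> cbox l (2 *\<^sub>R l) \<Longrightarrow> - (\<theta> \<bullet> x) \<le> D"
    and la: "\<And>i. \<kappa> * a $ i \<le> l $ i" and pos: "0 < \<kappa>" "0 < K" "\<And>i. 0 < a $ i"
  shows "\<kappa> * exp (- D) / 2 * (\<kappa> / K) ^ CARD('n) * a $ i \<le> gibbs_mean P \<theta> $ i"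
    and "gibbs_mean P \<theta> $ i \<le> K * a $ i" and "interior P \<noteq> {}"
proof -
  let ?Z = "gibbs_integral P \<theta> (\<lambda>_. 1 :: real)" and ?N = "2 ^ (CARD('n) + 1) :: real"
  define B where "B = cbox l (2 *\<^sub>R l)"
  define C where "C = cbox 0 (K *\<^sub>R a)"
  have l_pos: "0 < l $ i" for i
    using la[of i] pos(1) pos(3)[of i] by (meson less_le_trans mult_pos_pos)
  have "box l (2 *\<^sub>R l) \<noteq> {}"
    using l_pos by (auto simp: box_ne_empty Basis_vec_def inner_axis)
  moreover have "box l (2 *\<^sub>R l) \<subseteq> interior P"
    using lower(1) box_subset_cbox by (intro interior_maximal) auto
  ultimately show int: "interior P \<noteq> {}" by blast
  note Z = gibbs_partition_pos[OF P(1) int, of \<theta>]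
  have mean_obj: "- (\<theta> \<bullet> gibbs_mean P \<theta>) \<le> ?N"
    using gibbs_mean_objective_le[OF P(1,2) int P(3)] by simp
  show "gibbs_mean P \<theta> $ i \<le> K * a $ i"
  proof (rule upper)
    show "gibbs_mean P \<theta> \<in> P"
      using gibbs_mean_in_interior[OF P(1,2) int] interior_subset by blast
    show "- (\<theta> \<bullet> gibbs_mean P \<theta>) \<le> 2 ^ (CARD('n) + 2)"
      using mean_obj by (rule order_trans) simp
  qed
  have meas: "measure lborel C = K ^ CARD('n) * (\<Prod>i\<in>UNIV. a $ i)" "measure lborel B = (\<Prod>i\<in>UNIV. l $ i)"
  proof -
    have "C \<noteq> {}" "B \<noteq> {}"
      using pos l_pos by (auto simp: C_def B_def box_ne_empty Basis_vec_def inner_axis less_imp_le)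
    then show "measure lborel C = K ^ CARD('n) * (\<Prod>i\<in>UNIV. a $ i)" "measure lborel B = (\<Prod>i\<in>UNIV. l $ i)"
      by (simp_all add: C_def B_def content_cbox_cart prod.distrib)
  qed
  have int_P: "integrable lborel (\<lambda>x. indicator P x *\<^sub>R (exp (\<theta> \<bullet> x) *\<^sub>R f x))" if "continuous_on P f" for f :: "_ \<Rightarrow> real"
    using set_integrable_gibbs[OF P(1) that] by (simp add: set_integrable_def)
  have int_box: "integrable lborel (\<lambda>x. e * indicator (cbox u v) x)" for e :: real and u v :: "real ^ 'n"
    by (intro integrable_mult_right integrable_real_indicator) (auto intro: emeasure_bounded_finite[OF bounded_cbox, unfolded infinity_ennreal_def])
  \<comment> \<open>Markov's inequality in the form that the weight \<open>1 + (\<theta> \<bullet> x) / (2 N)\<close> has mean at least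
    \<open>1 / 2\<close>; it is at most \<open>1\<close> on \<open>P\<close>, and negative outside the truncation, hence outside \<open>C\<close>.\<close>
  have "?Z / 2 \<le> ?Z * (1 - (- (\<theta> \<bullet> gibbs_mean P \<theta>)) / (2 * ?N))"
  proof -
    have "- (\<theta> \<bullet> gibbs_mean P \<theta>) / (2 * ?N) \<le> 1 / 2"
      using mean_obj by (simp add: field_simps)
    then have "?Z * (1 / 2) \<le> ?Z * (1 - (- (\<theta> \<bullet> gibbs_mean P \<theta>)) / (2 * ?N))"
      using Z by (intro mult_left_mono) auto
    then show ?thesis by simp
  qed
  also have "\<dots> = ?Z + (1 / (2 * ?N)) * gibbs_integral P \<theta> (\<lambda>x. \<theta> \<bullet> x)"
    using Z by (simp add: inner_gibbs_mean[OF P(1)] field_simps)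
  also have "\<dots> = gibbs_integral P \<theta> (\<lambda>x. 1 + (1 / (2 * ?N)) * (\<theta> \<bullet> x))"
    using P by (subst gibbs_integral_add) (auto intro!: continuous_intros simp only: gibbs_integral_cmult)
  also have "\<dots> \<le> (LINT x|lborel. 1 * indicator C x)"
    unfolding gibbs_integral_def set_lebesgue_integral_def C_def
  proof (intro integral_mono int_P int_box continuous_intros)
    fix x
    show "indicator P x *\<^sub>R (exp (\<theta> \<bullet> x) *\<^sub>R (1 + (1 / (2 * ?N)) * (\<theta> \<bullet> x))) \<le> 1 * indicator (cbox 0 (K *\<^sub>R a)) x"
    proof (cases "x \<in> P")
      case True
      show ?thesis
      proof (cases "- (\<theta> \<bullet> x) \<le> 2 * ?N")
        case le: True
        then have "x \<in> cbox 0 (K *\<^sub>R a)"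
          using upper[OF True] nonneg(2)[OF True] by (simp add: mem_box_cart)
        moreover have "exp (\<theta> \<bullet> x) * (1 + (1 / (2 * ?N)) * (\<theta> \<bullet> x)) \<le> 1 * 1"
          using nonneg(1)[OF True] le by (intro mult_mono) (auto simp: field_simps)
        ultimately show ?thesis using True by simp
      next
        case False
        then have "1 + (1 / (2 * ?N)) * (\<theta> \<bullet> x) \<le> 0"
          by (simp add: field_simps)
        then have "exp (\<theta> \<bullet> x) * (1 + (1 / (2 * ?N)) * (\<theta> \<bullet> x)) \<le> 0"
          by (intro mult_nonneg_nonpos) auto
        also have "0 \<le> 1 * indicat_real (cbox 0 (K *\<^sub>R a)) x" by simp
        finally show ?thesis using True by simp
      qed
    qed simp
  qed
  also have "\<dots> = K ^ CARD('n) * (\<Prod>i\<in>UNIV. a $ i)"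
    using meas by simp
  finally have Z_le: "?Z / 2 \<le> K ^ CARD('n) * (\<Prod>i\<in>UNIV. a $ i)" .
  have "l $ i * exp (- D) * (\<Prod>i\<in>UNIV. l $ i) = (LINT x|lborel. l $ i * exp (- D) * indicator B x)"
    using meas by simp
  also have "\<dots> \<le> gibbs_integral P \<theta> (\<lambda>x. x $ i)"
    unfolding gibbs_integral_def set_lebesgue_integral_def B_def
  proof (intro integral_mono int_P int_box continuous_intros)
    fix x
    show "l $ i * exp (- D) * indicator (cbox l (2 *\<^sub>R l)) x \<le> indicator P x *\<^sub>R (exp (\<theta> \<bullet> x) *\<^sub>R x $ i)"
    proof (cases "x \<in> cbox l (2 *\<^sub>R l)")
      case True
      then have "l $ i * exp (- D) \<le> x $ i * exp (\<theta> \<bullet> x)"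
        using lower(2)[OF True] l_pos[of i] by (intro mult_mono) (auto simp: mem_box_cart intro: order_trans less_imp_le)
      then show ?thesis
        using True lower(1) by (auto simp: mult.commute)
    qed (use nonneg(2) in \<open>auto simp: indicator_def\<close>)
  qed
  finally have num: "l $ i * exp (- D) * (\<Prod>i\<in>UNIV. l $ i) \<le> gibbs_integral P \<theta> (\<lambda>x. x $ i)" .
  have "\<kappa> ^ CARD('n) * (\<Prod>i\<in>UNIV. a $ i) = (\<Prod>i\<in>UNIV. \<kappa> * a $ i)"
    by (simp add: prod.distrib)
  also have "\<dots> \<le> (\<Prod>i\<in>UNIV. l $ i)"
    using la pos by (intro prod_mono) (auto simp: less_imp_le)
  finally have prod_l: "\<kappa> ^ CARD('n) * (\<Prod>i\<in>UNIV. a $ i) \<le> (\<Prod>i\<in>UNIV. l $ i)" .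
  have "(\<kappa> * exp (- D) / 2 * (\<kappa> / K) ^ CARD('n) * a $ i) * ?Z
      = (\<kappa> * a $ i) * exp (- D) * (\<kappa> / K) ^ CARD('n) * (?Z / 2)"
    by simp
  also have "\<dots> \<le> (\<kappa> * a $ i) * exp (- D) * (\<kappa> / K) ^ CARD('n) * (K ^ CARD('n) * (\<Prod>i\<in>UNIV. a $ i))"
    using pos by (intro mult_left_mono Z_le) (auto simp: less_imp_le)
  also have "\<dots> = (\<kappa> * a $ i) * exp (- D) * (\<kappa> ^ CARD('n) * (\<Prod>i\<in>UNIV. a $ i))"
    using pos by (simp add: power_divide)
  also have "\<dots> \<le> l $ i * exp (- D) * (\<Prod>i\<in>UNIV. l $ i)"
    using pos l_pos by (intro mult_mono la prod_l) (auto simp: less_imp_le intro!: prod_nonneg mult_nonneg_nonneg)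
  also note num
  finally show "\<kappa> * exp (- D) / 2 * (\<kappa> / K) ^ CARD('n) * a $ i \<le> gibbs_mean P \<theta> $ i"
    using Z inner_gibbs_mean[OF P(1), of "axis i 1" \<theta>] by (simp add: inner_axis' pos_le_divide_eq)
qed

section \<open>Asymptotics of Puiseux series with positive leading coefficient\<close>

text \<open>Infinitely many exponents above \<open>x\<close> would accumulate somewhere in \<open>[x, \<infinity>]\<close>, which is compact in
  the extended reals.\<close>

lemma puiseux_supp_atLeast_finite:
  assumes "z \<in> puiseux"
  shows "finite (puiseux_supp z \<inter> {x..})"
proof (rule ccontr)
  let ?S = "puiseux_supp z"
  assume inf: "infinite (?S \<inter> {x..})"
  then have lim: "{a. a islimpt (ereal ` ?S)} = {- \<infinity>}"
    using assms by (auto simp: puiseux_def)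
  have "infinite (ereal ` (?S \<inter> {x..}))"
    using inf by (simp add: finite_image_iff)
  moreover have "ereal ` (?S \<inter> {x..}) \<subseteq> {ereal x..}" by auto
  ultimately obtain a where a: "a \<in> {ereal x..}" "a islimpt ereal ` (?S \<inter> {x..})"
    using Heine_Borel_imp_Bolzano_Weierstrass[of "{ereal x..}" "ereal ` (?S \<inter> {x..})"]
    by (auto simp: compact_eq_closed)
  then have "a islimpt ereal ` ?S"
    by (blast intro: islimpt_subset)
  then have "a \<in> {a. a islimpt ereal ` ?S}" by simp
  then have "a = - \<infinity>" unfolding lim by simp
  then show False using a(1) by simp
qed

text \<open>The bound \<open>\<beta>\<close> separates the leading exponent from all others; this gap is what makes the
  tail of the series negligible.\<close>

lemma puiseux_pos_leading_term:
  assumes z: "z \<in> puiseux_pos" and val: "puiseux_val z = ereal \<mu>"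
  obtains \<beta> where "\<mu> \<in> puiseux_supp z" "0 < z \<mu>" "\<beta> < \<mu>"
    "\<And>\<alpha>. \<alpha> \<in> puiseux_supp z \<Longrightarrow> \<alpha> \<noteq> \<mu> \<Longrightarrow> \<alpha> \<le> \<beta>"
proof -
  let ?S = "puiseux_supp z"
  have fin: "finite (?S \<inter> {x..})" for x
    using z by (intro puiseux_supp_atLeast_finite) (simp add: puiseux_pos_def)
  obtain x where x: "x \<in> ?S" using z by (auto simp: puiseux_pos_def)
  define m where "m = Max (?S \<inter> {x..})"
  have m: "m \<in> ?S \<inter> {x..}"
    unfolding m_def using x by (intro Max_in fin) auto
  have m_max: "\<alpha> \<le> m" if "\<alpha> \<in> ?S" for \<alpha>
  proof (cases "x \<le> \<alpha>")
    case True
    then show ?thesis unfolding m_def using that fin by (intro Max_ge) auto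
  qed (use m in auto)
  have "(GREATEST \<alpha>. \<alpha> \<in> ?S) = m"
    using m m_max by (intro Greatest_equality) auto
  then have \<mu>: "m = \<mu>" "0 < z \<mu>"
    using z val by (auto simp: puiseux_pos_def puiseux_val_def split: if_splits)
  define T where "T = insert (\<mu> - 1) (?S \<inter> {\<mu> - 1..} - {\<mu>})"
  have T: "finite T" "T \<noteq> {}" "\<forall>\<alpha>\<in>T. \<alpha> < \<mu>"
    using fin m_max \<mu> by (auto simp: T_def less_le)
  show thesis
  proof (rule that[of "Max T"])
    show "\<mu> \<in> ?S" "0 < z \<mu>" "Max T < \<mu>"
      using m \<mu> T by auto
    fix \<alpha> assume \<alpha>: "\<alpha> \<in> ?S" "\<alpha> \<noteq> \<mu>"
    show "\<alpha> \<le> Max T"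
    proof (cases "\<mu> - 1 \<le> \<alpha>")
      case True
      then show ?thesis using \<alpha> T(1) by (intro Max_ge) (auto simp: T_def)
    next
      case False
      have "\<mu> - 1 \<le> Max T" using T(1) by (intro Max_ge) (auto simp: T_def)
      with False show ?thesis by simp
    qed
  qed
qed

text \<open>For \<open>t \<ge> s\<close> and \<open>\<alpha> \<le> \<beta>\<close> each term satisfies \<open>t\<^sup>\<alpha> \<le> (t / s)\<^sup>\<beta> s\<^sup>\<alpha>\<close>. So the tail at \<open>t\<close> is at most
  \<open>(t / s)\<^sup>\<beta>\<close> times the absolutely convergent tail at the fixed \<open>s\<close>, which is of lower order than
  \<open>t\<^sup>\<mu>\<close>.\<close>

lemma puiseux_eval_asymp:
  assumes z: "z \<in> puiseux_pos" and val: "puiseux_val z = ereal \<mu>"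
  shows "0 < z \<mu>" "((\<lambda>t. puiseux_eval z t / t powr \<mu>) \<longlongrightarrow> z \<mu>) at_top"
proof -
  let ?S = "puiseux_supp z"
  obtain \<beta> where lead: "\<mu> \<in> ?S" "0 < z \<mu>" "\<beta> < \<mu>" "\<And>\<alpha>. \<alpha> \<in> ?S \<Longrightarrow> \<alpha> \<noteq> \<mu> \<Longrightarrow> \<alpha> \<le> \<beta>"
    using puiseux_pos_leading_term[OF assms] by blast
  show "0 < z \<mu>" by fact
  have "\<forall>\<^sub>F t in at_top. (\<lambda>\<alpha>. \<bar>z \<alpha> * t powr \<alpha>\<bar>) summable_on ?S"
    using z by (simp add: puiseux_pos_def puiseux_def)
  then obtain t1 where t1: "\<And>t. t1 \<le> t \<Longrightarrow> (\<lambda>\<alpha>. \<bar>z \<alpha> * t powr \<alpha>\<bar>) summable_on ?S"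
    by (auto simp: eventually_at_top_linorder)
  define s where "s = max t1 1"
  have s: "1 \<le> s" "\<And>t. s \<le> t \<Longrightarrow> (\<lambda>\<alpha>. \<bar>z \<alpha> * t powr \<alpha>\<bar>) summable_on ?S"
    using t1 by (auto simp: s_def)
  let ?R = "?S - {\<mu>}"
  define C where "C = (\<Sum>\<^sub>\<infinity>\<alpha>\<in>?R. \<bar>z \<alpha> * s powr \<alpha>\<bar>)"
  have bound: "norm (puiseux_eval z t / t powr \<mu> - z \<mu>) \<le> (C * s powr (- \<beta>)) * t powr (\<beta> - \<mu>)" if t: "s \<le> t" for t
  proof -
    have abs: "(\<lambda>\<alpha>. norm (z \<alpha> * t powr \<alpha>)) summable_on ?R"
      using s(2)[OF t] by (auto intro: summable_on_subset_banach)
    have abs_s: "(\<lambda>\<alpha>. \<bar>z \<alpha> * s powr \<alpha>\<bar>) summable_on ?R"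
      using s(2)[OF order_refl] by (auto intro: summable_on_subset_banach)
    have "puiseux_eval z t = (\<Sum>\<^sub>\<infinity>\<alpha>\<in>{\<mu>} \<union> ?R. z \<alpha> * t powr \<alpha>)"
      using lead(1) by (simp add: puiseux_eval_def insert_absorb)
    also have "\<dots> = z \<mu> * t powr \<mu> + (\<Sum>\<^sub>\<infinity>\<alpha>\<in>?R. z \<alpha> * t powr \<alpha>)"
      using abs_summable_summable[OF abs] by (subst infsum_Un_disjoint) auto
    finally have "puiseux_eval z t / t powr \<mu> - z \<mu> = (\<Sum>\<^sub>\<infinity>\<alpha>\<in>?R. z \<alpha> * t powr \<alpha>) / t powr \<mu>"
      using s(1) t by (simp add: field_simps)
    then have "norm (puiseux_eval z t / t powr \<mu> - z \<mu>) = norm (\<Sum>\<^sub>\<infinity>\<alpha>\<in>?R. z \<alpha> * t powr \<alpha>) / t powr \<mu>"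
      by (simp add: norm_divide)
    also have "norm (\<Sum>\<^sub>\<infinity>\<alpha>\<in>?R. z \<alpha> * t powr \<alpha>) \<le> (\<Sum>\<^sub>\<infinity>\<alpha>\<in>?R. norm (z \<alpha> * t powr \<alpha>))"
      by (rule norm_infsum_bound[OF abs])
    also have "\<dots> \<le> (\<Sum>\<^sub>\<infinity>\<alpha>\<in>?R. (t / s) powr \<beta> * \<bar>z \<alpha> * s powr \<alpha>\<bar>)"
    proof (intro infsum_mono abs summable_on_cmult_right abs_s)
      fix \<alpha> assume "\<alpha> \<in> ?R"
      then have "(t / s) powr \<alpha> \<le> (t / s) powr \<beta>"
        using lead(4) s(1) t by (intro powr_mono) auto
      moreover have "t powr \<alpha> = (t / s) powr \<alpha> * s powr \<alpha>"
        using s(1) t by (simp flip: powr_mult)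
      ultimately show "norm (z \<alpha> * t powr \<alpha>) \<le> (t / s) powr \<beta> * \<bar>z \<alpha> * s powr \<alpha>\<bar>"
        by (simp add: abs_mult mult_left_mono mult_right_mono mult.left_commute)
    qed
    also have "\<dots> = (t / s) powr \<beta> * C"
      unfolding C_def by (intro infsum_cmult_right abs_s)
    also have "(t / s) powr \<beta> = t powr \<beta> * s powr (- \<beta>)"
      using s(1) t by (simp add: powr_divide powr_minus_divide)
    finally show ?thesis
      by (simp add: divide_right_mono powr_diff mult_ac)
  qed
  have "((\<lambda>t. (C * s powr (- \<beta>)) * t powr (\<beta> - \<mu>)) \<longlongrightarrow> (C * s powr (- \<beta>)) * 0) at_top"
    using lead(3) by (intro tendsto_mult_left tendsto_neg_powr filterlim_ident) auto
  then have "((\<lambda>t. puiseux_eval z t / t powr \<mu> - z \<mu>) \<longlongrightarrow> 0) at_top"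
    unfolding mult_zero_right
    by (rule Lim_null_comparison[rotated]) (use bound in \<open>auto simp: eventually_at_top_linorder\<close>)
  then show "((\<lambda>t. puiseux_eval z t / t powr \<mu>) \<longlongrightarrow> z \<mu>) at_top"
    by (simp add: LIM_zero_iff)
qed

corollary
  assumes z: "z \<in> puiseux_pos" and val: "puiseux_val z = ereal \<mu>"
  shows puiseux_eval_eventually_pos: "\<forall>\<^sub>F t in at_top. 0 < puiseux_eval z t"
    and log_puiseux_eval_tendsto: "((\<lambda>t. log t (puiseux_eval z t)) \<longlongrightarrow> \<mu>) at_top"
proof -
  note asymp = puiseux_eval_asymp[OF assms]
  have "\<forall>\<^sub>F t in at_top. 0 < puiseux_eval z t / t powr \<mu>"
    using asymp by (intro order_tendstoD)
  then show pos: "\<forall>\<^sub>F t in at_top. 0 < puiseux_eval z t"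
    by eventually_elim (auto simp: zero_less_divide_iff)
  have "((\<lambda>t. \<mu> + ln (puiseux_eval z t / t powr \<mu>) * inverse (ln t)) \<longlongrightarrow> \<mu> + ln (z \<mu>) * 0) at_top"
    using asymp by (intro tendsto_intros tendsto_inverse_0_at_top ln_at_top) auto
  moreover have "\<forall>\<^sub>F t in at_top. \<mu> + ln (puiseux_eval z t / t powr \<mu>) * inverse (ln t) = log t (puiseux_eval z t)"
    using pos eventually_gt_at_top[of 1]
    by eventually_elim (simp add: log_def ln_div ln_powr field_simps)
  ultimately show "((\<lambda>t. log t (puiseux_eval z t)) \<longlongrightarrow> \<mu>) at_top"
    by (simp add: filterlim_cong)
qed

lemma puiseux_monomial_exists: "\<exists>z\<in>puiseux_pos. puiseux_val z = ereal \<mu>"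
proof -
  let ?z = "\<lambda>\<alpha>::real. if \<alpha> = \<mu> then 1 else 0 :: real"
  have supp: "puiseux_supp ?z = {\<mu>}" by (auto simp: puiseux_supp_def)
  have "(GREATEST \<alpha>. \<alpha> \<in> {\<mu>}) = \<mu>" by (rule Greatest_equality) auto
  then have "?z \<in> puiseux_pos" "puiseux_val ?z = ereal \<mu>"
    by (simp_all add: puiseux_pos_def puiseux_def puiseux_val_def supp)
  then show ?thesis by blast
qed

section \<open>Linear pieces of functions on a uniform grid\<close>

definition grid_cell :: "real \<Rightarrow> nat \<Rightarrow> real set" where
  "grid_cell h k = {real k * h .. real (Suc k) * h}"

lemma is_interval_grid_cell [simp]: "is_interval (grid_cell h k)"
  by (simp add: grid_cell_def is_interval_cc)

lemma grid_cell_subset: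
  assumes "0 < h" "k < N"
  shows "grid_cell h k \<subseteq> {0..real N * h}"
proof -
  have "real (Suc k) * h \<le> real N * h"
    using assms by (intro mult_right_mono) auto
  moreover have "0 \<le> real k * h"
    using assms by simp
  ultimately show ?thesis
    by (simp add: grid_cell_def)
qed

lemma grid_cell_covers:
  assumes "0 < h" "0 \<le> x" "x < real N * h"
  obtains k where "k < N" "x \<in> grid_cell h k" "x < real (Suc k) * h"
proof
  let ?k = "nat \<lfloor>x / h\<rfloor>"
  have nn: "0 \<le> \<lfloor>x / h\<rfloor>"
    using assms by simp
  have "x / h < real N"
    using assms by (simp add: field_simps)
  then show "?k < N"
    using nn by linarith
  have "real ?k \<le> x / h" "x / h < real (Suc ?k)"
    using nn by linarith+
  then show "x \<in> grid_cell h ?k" "x < real (Suc ?k) * h"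
    using assms(1) by (auto simp: grid_cell_def field_simps)
qed

lemma Union_grid_cells:
  assumes "0 < h" "1 \<le> N"
  shows "(\<Union>k<N. grid_cell h k) = {0..real N * h}"
proof
  show "(\<Union>k<N. grid_cell h k) \<subseteq> {0..real N * h}"
    using grid_cell_subset[OF assms(1)] by blast
  show "{0..real N * h} \<subseteq> (\<Union>k<N. grid_cell h k)"
  proof
    fix x assume x: "x \<in> {0..real N * h}"
    show "x \<in> (\<Union>k<N. grid_cell h k)"
    proof (cases "x = real N * h")
      case True
      have "N = Suc (N - 1)" using assms(2) by simp
      with True have "x \<in> grid_cell h (N - 1)"
        using assms(1) by (auto simp: grid_cell_def mult_right_mono)
      then show ?thesis using assms(2) by auto
    next
      case False
      then obtain k where "k < N" "x \<in> grid_cell h k"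
        using grid_cell_covers[OF assms(1), of x N] x by auto
      then show ?thesis by blast
    qed
  qed
qed

lemma inj_grid_cell:
  assumes "0 < h"
  shows "inj (grid_cell h)"
proof (rule injI)
  fix k l assume "grid_cell h k = grid_cell h l"
  then show "k = l"
    using assms by (simp add: grid_cell_def Icc_eq_Icc)
qed

lemma grid_cell_subset_iff:
  assumes "0 < h"
  shows "grid_cell h k \<subseteq> grid_cell h l \<longleftrightarrow> k = l"
  using assms by (auto simp: grid_cell_def)

lemma affine_on_second_difference:
  assumes "affine_on J f" "p \<in> J" "p + e \<in> J" "p - e \<in> J"
  shows "f (p + e) - f p = f p - f (p - e)"
proof -
  obtain a b where "\<forall>x\<in>J. f x = a + x *\<^sub>R b"
    using assms(1) by (auto simp: affine_on_def)
  with assms(2-) show ?thesis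
    by (simp add: algebra_simps)
qed

lemma affine_on_imp_no_kink:
  assumes "affine_on J f" "p \<in> interior J" "0 < h"
  obtains e where "0 < e" "e \<le> h" "f (p + e) - f p = f p - f (p - e)"
proof -
  obtain d where d: "0 < d" "cball p d \<subseteq> J"
    using assms(2) by (auto simp: mem_interior_cball)
  let ?e = "min d h"
  have "p \<in> cball p d" "p + ?e \<in> cball p d" "p - ?e \<in> cball p d"
    using d(1) assms(3) by (auto simp: dist_real_def)
  then have "f (p + ?e) - f p = f p - f (p - ?e)"
    using affine_on_second_difference[OF assms(1)] d(2) by blast
  with that[of ?e] d(1) assms(3) show thesis by simp
qed

text \<open>A function that is affine on each cell of a uniform grid, and has a kink at each interior knot,
  has exactly the cells as its linear pieces. The kinks are expressed by second differences, so
  that the slopes on the cells need not be known.\<close>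

context
  fixes f :: "real \<Rightarrow> 'a::real_vector" and h :: real and N :: nat
  assumes h: "0 < h" and N: "1 \<le> N"
    and affine: "\<And>k. k < N \<Longrightarrow> affine_on (grid_cell h k) f"
    and kink: "\<And>k e. Suc k < N \<Longrightarrow> 0 < e \<Longrightarrow> e \<le> h \<Longrightarrow>
      f (real (Suc k) * h + e) - f (real (Suc k) * h) \<noteq> f (real (Suc k) * h) - f (real (Suc k) * h - e)"
begin

lemma knot_not_interior:
  assumes "affine_on J f" "Suc k < N"
  shows "real (Suc k) * h \<notin> interior J"
  using affine_on_imp_no_kink[OF assms(1) _ h] kink[OF assms(2)] by metis

text \<open>An interval that leaves the cell of one of its interior points has an end of this cell in its
  interior.\<close>

lemma affinity_interval_in_grid_cell:
  assumes "J \<in> affinity_intervals {0..real N * h} f"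
  obtains k where "k < N" "J \<subseteq> grid_cell h k"
proof -
  have J: "J \<subseteq> {0..real N * h}" "is_interval J" "interior J \<noteq> {}" "affine_on J f"
    using assms by (auto simp: affinity_intervals_def)
  obtain p where p: "p \<in> interior J" using J(3) by blast
  have "interior J \<subseteq> {0<..<real N * h}"
    using interior_mono[OF J(1)] by simp
  then have "0 \<le> p" "p < real N * h" using p by auto
  then obtain k where k: "k < N" "p \<in> grid_cell h k" "p < real (Suc k) * h"
    using grid_cell_covers[OF h] by blast
  have between: "w \<in> interior J" if "a \<in> J" "b \<in> J" "a < w" "w < b" for a b w
  proof -
    have "{a..b} \<subseteq> J"
      using J(2)[unfolded is_interval_1] that(1,2) by (meson atLeastAtMost_iff subsetI)
    then have "{a<..<b} \<subseteq> interior J"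
      by (metis interior_mono interior_atLeastAtMost_real)
    then show ?thesis using that by auto
  qed
  have "real k * h \<le> q \<and> q \<le> real (Suc k) * h" if q: "q \<in> J" for q
  proof (intro conjI; rule ccontr)
    assume "\<not> real k * h \<le> q"
    then have less: "q < real k * h" by simp
    have "k \<noteq> 0"
    proof
      assume "k = 0"
      with less q J(1) show False by auto
    qed
    then obtain k' where k': "k = Suc k'" using not0_implies_Suc by blast
    obtain e where e: "0 < e" "cball p e \<subseteq> J"
      using p by (auto simp: mem_interior_cball)
    then have "p + e \<in> J" by (auto simp: dist_real_def)
    moreover have "real k * h < p + e"
      using k(2) e(1) by (simp add: grid_cell_def)
    ultimately have "real (Suc k') * h \<in> interior J"
      using between[OF q _ less] by (simp add: k')
    then show False
      using knot_not_interior[OF J(4)] k(1) k' by blast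
  next
    assume "\<not> q \<le> real (Suc k) * h"
    then have less: "real (Suc k) * h < q" by simp
    also have "q \<le> real N * h" using q J(1) by auto
    finally have "Suc k < N" using h by simp
    moreover have "real (Suc k) * h \<in> interior J"
      using between[OF _ q k(3) less] p interior_subset by blast
    ultimately show False
      using knot_not_interior[OF J(4)] by blast
  qed
  then show thesis
    using that[OF k(1)] unfolding grid_cell_def by (meson atLeastAtMost_iff subsetI)
qed

lemma grid_cell_affinity_interval:
  assumes "k < N"
  shows "grid_cell h k \<in> affinity_intervals {0..real N * h} f"
  using grid_cell_subset[OF h assms] affine[OF assms] h
  by (simp add: affinity_intervals_def) (simp add: grid_cell_def)

theorem linear_pieces_eq_grid_cells:
  "linear_pieces {0..real N * h} f = grid_cell h ` {..<N}"
proof (intro equalityI subsetI)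
  fix J assume J: "J \<in> linear_pieces {0..real N * h} f"
  then obtain k where k: "k < N" "J \<subseteq> grid_cell h k"
    using affinity_interval_in_grid_cell by (auto simp: linear_pieces_def)
  then have "grid_cell h k = J"
    using J grid_cell_affinity_interval[OF k(1)] by (auto simp: linear_pieces_def)
  then show "J \<in> grid_cell h ` {..<N}" using k(1) by blast
next
  fix J assume "J \<in> grid_cell h ` {..<N}"
  then obtain k where k: "k < N" "J = grid_cell h k" by auto
  have "K = J" if K: "K \<in> affinity_intervals {0..real N * h} f" and sub: "J \<subseteq> K" for K
  proof -
    obtain l where l: "l < N" "K \<subseteq> grid_cell h l"
      using affinity_interval_in_grid_cell[OF K] by blast
    then have "k = l"
      using grid_cell_subset_iff[OF h] sub k(2) by blast
    with l sub k(2) show ?thesis by blast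
  qed
  then show "J \<in> linear_pieces {0..real N * h} f"
    using grid_cell_affinity_interval[OF k(1)] k(2) by (simp add: linear_pieces_def)
qed

corollary card_linear_pieces_grid: "card (linear_pieces {0..real N * h} f) = N"
  using inj_on_subset[OF inj_grid_cell[OF h]] by (simp add: linear_pieces_eq_grid_cells card_image)

corollary piecewise_linear_on_grid: "piecewise_linear_on {0..real N * h} f"
  unfolding piecewise_linear_on_def
  by (rule exI[of _ "grid_cell h ` {..<N}"]) (auto simp: Union_grid_cells[OF h N] affine)

end

section \<open>The tropical recursion\<close>

text \<open>The value at level \<open>j\<close> is the pair of the coordinates \<open>2j+1\<close> and \<open>2j+2\<close> of the tropical path.
  The base case is \<open>(min 2 \<mu>, 1 + min 0 \<mu>)\<close>, simplified for \<open>0 \<le> \<mu> \<le> 2\<close>.\<close>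

primrec trop_level :: "nat \<Rightarrow> real \<Rightarrow> real \<times> real" where
  "trop_level 0 \<mu> = (\<mu>, 1)"
| "trop_level (Suc j) \<mu> =
    (1 + min (fst (trop_level j \<mu>)) (snd (trop_level j \<mu>)),
     1 - 1 / 2 ^ Suc j + max (fst (trop_level j \<mu>)) (snd (trop_level j \<mu>)))"

lemma continuous_on_trop_level:
  "continuous_on S (\<lambda>\<mu>. fst (trop_level j \<mu>))" "continuous_on S (\<lambda>\<mu>. snd (trop_level j \<mu>))"
  by (induction j) (auto intro!: continuous_intros)

text \<open>The middle of cell \<open>l\<close> of the grid with mesh \<open>2 / 2\<^sup>j\<close> is \<open>(2 l + 1) / 2\<^sup>j\<close>; its left half is
  the cell \<open>2 l\<close> of the next grid, and its right half is the cell \<open>2 l + 1\<close>.\<close>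

lemma grid_cell_halve:
  assumes "x \<in> grid_cell (2 / 2 ^ Suc j) k"
  shows "x \<in> grid_cell (2 / 2 ^ j) (k div 2)"
    "even k \<Longrightarrow> x \<le> (2 * real (k div 2) + 1) / 2 ^ j"
    "odd k \<Longrightarrow> (2 * real (k div 2) + 1) / 2 ^ j \<le> x"
proof -
  have x: "real k / 2 ^ j \<le> x" "x \<le> (real k + 1) / 2 ^ j"
    using assms by (simp_all add: grid_cell_def add.commute)
  have k: "real k = 2 * real (k div 2) + (if even k then 0 else 1)"
    by (cases "even k") (auto elim!: evenE oddE)
  have le: "a / 2 ^ j \<le> b / 2 ^ j" if "a \<le> b" for a b :: real
    using that by (simp add: divide_right_mono)
  show "x \<in> grid_cell (2 / 2 ^ j) (k div 2)"
    using order_trans[OF le x(1), of "2 * real (k div 2)"] order_trans[OF x(2) le, of "2 * real (k div 2) + 2"] k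
    by (auto simp: grid_cell_def algebra_simps split: if_splits)
  show "even k \<Longrightarrow> x \<le> (2 * real (k div 2) + 1) / 2 ^ j" "odd k \<Longrightarrow> (2 * real (k div 2) + 1) / 2 ^ j \<le> x"
    using x k by auto
qed

text \<open>The zigzag: the difference \<open>d\<^sub>j\<close> satisfies \<open>d\<^sub>j\<^sub>+\<^sub>1 = 2\<^sup>-\<^sup>j\<^sup>-\<^sup>1 - \<bar>d\<^sub>j\<bar>\<close>, and \<open>2\<^sup>-\<^sup>j\<^sup>-\<^sup>1\<close> is the
  distance between the middle of a cell and the middle of either half.\<close>

lemma trop_level_difference:
  assumes "k < 2 ^ j" "x \<in> grid_cell (2 / 2 ^ j) k"
  shows "fst (trop_level j x) - snd (trop_level j x) =
    (if even k then 1 else - 1) * (x - (2 * real k + 1) / 2 ^ j)"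
  using assms
proof (induction j arbitrary: k)
  case 0
  then show ?case by simp
next
  case (Suc j)
  let ?mid = "(2 * real (k div 2) + 1) / 2 ^ j"
  note half = grid_cell_halve[OF Suc.prems(2)]
  have "k div 2 < 2 ^ j" using Suc.prems(1) by simp
  then have "\<bar>fst (trop_level j x) - snd (trop_level j x)\<bar> = \<bar>x - ?mid\<bar>"
    using Suc.IH[OF _ half(1)] by (simp add: abs_mult)
  moreover have "fst (trop_level (Suc j) x) - snd (trop_level (Suc j) x)
      = 1 / 2 ^ Suc j - \<bar>fst (trop_level j x) - snd (trop_level j x)\<bar>"
    by (simp add: min_def max_def)
  ultimately have diff: "fst (trop_level (Suc j) x) - snd (trop_level (Suc j) x) = 1 / 2 ^ Suc j - \<bar>x - ?mid\<bar>"
    by simp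
  show ?case
  proof (cases "even k")
    case True
    then have "?mid - (2 * real k + 1) / 2 ^ Suc j = 1 / 2 ^ Suc j"
      by (auto elim!: evenE simp: field_simps)
    moreover have "d - \<bar>x - m\<bar> = 1 * (x - c)" if "m - c = d" "x \<le> m" for c d m
      using that by simp
    ultimately show ?thesis
      using half(2)[OF True] unfolding diff if_P[OF True] by blast
  next
    case False
    then have "(2 * real k + 1) / 2 ^ Suc j - ?mid = 1 / 2 ^ Suc j"
      by (auto elim!: oddE simp: field_simps)
    moreover have "d - \<bar>x - m\<bar> = - 1 * (x - c)" if "c - m = d" "m \<le> x" for c d m
      using that by simp
    ultimately show ?thesis
      using half(3)[OF False] unfolding diff if_not_P[OF False] by blast
  qed
qed

text \<open>Which of the two entries is the smaller one changes exactly in the middle of a cell. Whatever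
  the orientation in the cell, the minimum therefore has slope \<open>1\<close> on the left half and \<open>0\<close> on the
  right half, and the maximum the other way round.\<close>

lemma trop_level_affine:
  assumes "k < 2 ^ j"
  shows "\<exists>a b. \<forall>x\<in>grid_cell (2 / 2 ^ j) k.
    fst (trop_level j x) = a + (if even k then x else 0) \<and>
    snd (trop_level j x) = b + (if even k then 0 else x)"
  using assms
proof (induction j arbitrary: k)
  case 0
  then have "k = 0" by simp
  then show ?case
    by (intro exI[of _ 0] exI[of _ 1]) simp
next
  case (Suc j)
  have k': "k div 2 < 2 ^ j" using Suc.prems by simp
  then obtain a b where ab: "\<forall>x\<in>grid_cell (2 / 2 ^ j) (k div 2).
    fst (trop_level j x) = a + (if even (k div 2) then x else 0) \<and>
    snd (trop_level j x) = b + (if even (k div 2) then 0 else x)"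
    using Suc.IH by blast
  define a' where "a' = 1 + (if even k \<longleftrightarrow> even (k div 2) then a else b)"
  define b' where "b' = 1 - 1 / 2 ^ Suc j + (if even k \<longleftrightarrow> even (k div 2) then b else a)"
  have "fst (trop_level (Suc j) x) = a' + (if even k then x else 0) \<and>
    snd (trop_level (Suc j) x) = b' + (if even k then 0 else x)"
    if x: "x \<in> grid_cell (2 / 2 ^ Suc j) k" for x
  proof -
    note half = grid_cell_halve[OF x]
    have le: "fst (trop_level j x) \<le> snd (trop_level j x)" if "even k \<longleftrightarrow> even (k div 2)"
      using trop_level_difference[OF k' half(1)] half(2,3) that by (cases "even k") auto
    have ge: "snd (trop_level j x) \<le> fst (trop_level j x)" if "\<not> (even k \<longleftrightarrow> even (k div 2))"
      using trop_level_difference[OF k' half(1)] half(2,3) that by (cases "even k") auto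
    show ?thesis
    proof (cases "even k \<longleftrightarrow> even (k div 2)")
      case True
      then show ?thesis
        using le[OF True] ab[rule_format, OF half(1)] by (simp add: a'_def b'_def)
    next
      case False
      then show ?thesis
        using ge[OF False] ab[rule_format, OF half(1)] by (auto simp: a'_def b'_def min_def max_def)
    qed
  qed
  then show ?case by blast
qed

text \<open>A cell of the last level lies in a single cell of each earlier level, so that all coordinates are
  affine on it.\<close>

lemma trop_level_affine_on:
  assumes "k < 2 ^ j" "i \<le> j"
  shows "\<exists>a b. \<forall>x\<in>grid_cell (2 / 2 ^ j) k. fst (trop_level i x) = a + x * b"
    "\<exists>a b. \<forall>x\<in>grid_cell (2 / 2 ^ j) k. snd (trop_level i x) = a + x * b"
proof -
  have "\<exists>l<2 ^ i. grid_cell (2 / 2 ^ j) k \<subseteq> grid_cell (2 / 2 ^ i) l"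
    using assms
  proof (induction j arbitrary: k)
    case (Suc j)
    show ?case
    proof (cases "i = Suc j")
      case False
      then have "\<exists>l<2 ^ i. grid_cell (2 / 2 ^ j) (k div 2) \<subseteq> grid_cell (2 / 2 ^ i) l"
        using Suc by simp
      moreover have "grid_cell (2 / 2 ^ Suc j) k \<subseteq> grid_cell (2 / 2 ^ j) (k div 2)"
        using grid_cell_halve(1) by blast
      ultimately show ?thesis by (meson order_trans)
    qed (use Suc.prems in auto)
  qed auto
  then obtain l where l: "l < 2 ^ i" "grid_cell (2 / 2 ^ j) k \<subseteq> grid_cell (2 / 2 ^ i) l" by blast
  obtain a b where ab: "\<forall>x\<in>grid_cell (2 / 2 ^ i) l.
    fst (trop_level i x) = a + (if even l then x else 0) \<and>
    snd (trop_level i x) = b + (if even l then 0 else x)"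
    using trop_level_affine[OF l(1)] by blast
  show "\<exists>a b. \<forall>x\<in>grid_cell (2 / 2 ^ j) k. fst (trop_level i x) = a + x * b"
    using ab l(2) by (intro exI[of _ a] exI[of _ "if even l then 1 else 0"]) auto
  show "\<exists>a b. \<forall>x\<in>grid_cell (2 / 2 ^ j) k. snd (trop_level i x) = a + x * b"
    using ab l(2) by (intro exI[of _ b] exI[of _ "if even l then 0 else 1"]) auto
qed

text \<open>The slope of the first entry alternates between \<open>0\<close> and \<open>1\<close> from cell to cell, so that the last
  level alone shows a kink at every knot.\<close>

lemma trop_level_kink:
  fixes j k :: nat
  defines "p \<equiv> real (Suc k) * (2 / 2 ^ j)"
  assumes "Suc k < 2 ^ j" "0 < e" "e \<le> 2 / 2 ^ j"
  shows "fst (trop_level j (p + e)) - fst (trop_level j p) \<noteq> fst (trop_level j p) - fst (trop_level j (p - e))"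
proof -
  have mem: "p \<in> grid_cell (2 / 2 ^ j) k" "p - e \<in> grid_cell (2 / 2 ^ j) k"
    "p \<in> grid_cell (2 / 2 ^ j) (Suc k)" "p + e \<in> grid_cell (2 / 2 ^ j) (Suc k)"
  proof -
    define d :: real where "d = 2 / 2 ^ j"
    have "p = real (Suc k) * d" "0 < d" "e \<le> d"
      using assms(4) by (simp_all add: p_def d_def)
    with assms(3) show "p \<in> grid_cell (2 / 2 ^ j) k" "p - e \<in> grid_cell (2 / 2 ^ j) k"
      "p \<in> grid_cell (2 / 2 ^ j) (Suc k)" "p + e \<in> grid_cell (2 / 2 ^ j) (Suc k)"
      unfolding d_def[symmetric] by (simp_all add: grid_cell_def algebra_simps)
  qed
  obtain a where a: "\<forall>x\<in>grid_cell (2 / 2 ^ j) k. fst (trop_level j x) = a + (if even k then x else 0)"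
    using trop_level_affine[of k j] assms(2) by auto
  obtain b where b: "\<forall>x\<in>grid_cell (2 / 2 ^ j) (Suc k). fst (trop_level j x) = b + (if even (Suc k) then x else 0)"
    using trop_level_affine[of "Suc k" j] assms(2) by blast
  show ?thesis
    using a[rule_format, OF mem(1)] a[rule_format, OF mem(2)] b[rule_format, OF mem(3)]
      b[rule_format, OF mem(4)] assms(3) by (auto split: if_splits)
qed

section \<open>The family of linear programs\<close>

text \<open>The greedy solution of the constraints, up to constant factors: the pair at level \<open>j\<close> is the
  order of magnitude of the variables \<open>2j+1\<close> and \<open>2j+2\<close> in the part of the polytope where the
  objective is \<open>O(M)\<close>. At level \<open>0\<close> the bounds \<open>M\<close> and \<open>t M\<close> come from the objective; at later
  levels those are implied by the constraints (\<open>lp_scale_le\<close>).\<close>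

primrec lp_scale :: "nat \<Rightarrow> real \<Rightarrow> real \<Rightarrow> real \<times> real" where
  "lp_scale 0 t M = (min (t\<^sup>2) M, t * min 1 M)"
| "lp_scale (Suc j) t M =
    (t * min (fst (lp_scale j t M)) (snd (lp_scale j t M)),
     t powr (1 - 1 / 2 ^ Suc j) * max (fst (lp_scale j t M)) (snd (lp_scale j t M)))"

lemma lp_scale_pos:
  assumes "1 \<le> t" "0 < M"
  shows "0 < fst (lp_scale j t M) \<and> 0 < snd (lp_scale j t M)"
  using assms by (induction j) (auto simp: less_max_iff_disj)

lemma lp_scale_le:
  assumes t: "1 \<le> t" and M: "0 < M"
  shows "fst (lp_scale j t M) \<le> t ^ Suc j * M \<and> snd (lp_scale j t M) \<le> t ^ Suc j * M"
proof (induction j)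
  case 0
  have "M \<le> t * M" using assms by simp
  moreover have "t * min 1 M \<le> t * M" using t by (intro mult_left_mono) auto
  ultimately show ?case by (simp add: min.coboundedI2)
next
  case (Suc j)
  let ?p = "fst (lp_scale j t M)" and ?q = "snd (lp_scale j t M)"
  have "t powr (1 - 1 / 2 ^ Suc j) \<le> t powr 1"
    using t by (intro powr_mono) auto
  then have "t powr (1 - 1 / 2 ^ Suc j) * max ?p ?q \<le> t * (t ^ Suc j * M)"
    using Suc t M lp_scale_pos[OF t M, of j] by (intro mult_mono) auto
  moreover have "t * min ?p ?q \<le> t * (t ^ Suc j * M)"
    using Suc t by (intro mult_left_mono) auto
  ultimately show ?case by (simp add: mult.assoc)
qed

text \<open>The constraints link the pair \<open>(x\<^sub>2\<^sub>j\<^sub>+\<^sub>1, x\<^sub>2\<^sub>j\<^sub>+\<^sub>2)\<close> at level \<open>j\<close> with the pair at level \<open>j + 1\<close>.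
  Levels are counted from \<open>0\<close>, so that inductions along the chain start at the pair
  \<open>(x\<^sub>1, x\<^sub>2)\<close>.\<close>

definition lp_odd :: "(nat \<Rightarrow> 'n) \<Rightarrow> real ^ 'n \<Rightarrow> nat \<Rightarrow> real" where
  "lp_odd ix x j = x $ ix (2 * j + 1)"

definition lp_even :: "(nat \<Rightarrow> 'n) \<Rightarrow> real ^ 'n \<Rightarrow> nat \<Rightarrow> real" where
  "lp_even ix x j = x $ ix (2 * j + 2)"

text \<open>The inverse of \<open>x \<mapsto> (\<lambda>j. (lp_odd ix x j, lp_even ix x j))\<close> on the levels below \<open>r\<close>.\<close>

definition vec_of_levels :: "nat \<Rightarrow> (nat \<Rightarrow> 'n) \<Rightarrow> (nat \<Rightarrow> real \<times> real) \<Rightarrow> real ^ 'n" where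
  "vec_of_levels r ix g = (\<chi> i. let k = the_inv_into {1..2 * r} ix i
    in if odd k then fst (g (k div 2)) else snd (g (k div 2 - 1)))"

lemma lp_odd_even_combine [simp]:
  "lp_odd ix (u *\<^sub>R x + v *\<^sub>R y) j = u * lp_odd ix x j + v * lp_odd ix y j"
  "lp_even ix (u *\<^sub>R x + v *\<^sub>R y) j = u * lp_even ix x j + v * lp_even ix y j"
  "lp_odd ix (u *\<^sub>R x) j = u * lp_odd ix x j"
  "lp_even ix (u *\<^sub>R x) j = u * lp_even ix x j"
  "lp_odd ix 0 j = 0" "lp_even ix 0 j = 0"
  by (simp_all add: lp_odd_def lp_even_def)

lemma continuous_on_lp_odd_even [continuous_intros]:
  "continuous_on S (\<lambda>x. lp_odd ix x j)" "continuous_on S (\<lambda>x. lp_even ix x j)"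
  unfolding lp_odd_def lp_even_def by (intro continuous_intros)+

context
  fixes r :: nat and ix :: "nat \<Rightarrow> 'n::finite"
  assumes r: "1 \<le> r" and ix: "bij_betw ix {1..2 * r} UNIV"
begin

lemma vec_of_levels_odd [simp]: "j < r \<Longrightarrow> lp_odd ix (vec_of_levels r ix g) j = fst (g j)"
  and vec_of_levels_even [simp]: "j < r \<Longrightarrow> lp_even ix (vec_of_levels r ix g) j = snd (g j)"
  using bij_betw_imp_inj_on[OF ix]
  by (simp_all add: lp_odd_def lp_even_def vec_of_levels_def the_inv_into_f_f)

lemma all_coordinates_iff:
  "(\<forall>i. Q i) \<longleftrightarrow> (\<forall>j<r. Q (ix (2 * j + 1)) \<and> Q (ix (2 * j + 2)))"
proof (intro iffI allI)
  fix i assume Q: "\<forall>j<r. Q (ix (2 * j + 1)) \<and> Q (ix (2 * j + 2))"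
  have "i \<in> ix ` {1..2 * r}"
    using bij_betw_imp_surj_on[OF ix] by simp
  then obtain k where k: "k \<in> {1..2 * r}" "i = ix k" by blast
  have "(\<exists>j<r. k = 2 * j + 1) \<or> (\<exists>j<r. k = 2 * j + 2)"
    using k(1) by (cases "even k") (auto elim!: oddE evenE intro: exI[of _ "k div 2 - 1"])
  then show "Q i" using Q k(2) by blast
qed auto

lemma lp_feasible_iff:
  "x \<in> lp_feasible r ix t \<longleftrightarrow>
    lp_odd ix x 0 \<le> t\<^sup>2 \<and> lp_even ix x 0 \<le> t \<and>
    (\<forall>j. Suc j < r \<longrightarrow>
      lp_odd ix x (Suc j) \<le> t * lp_odd ix x j \<and>
      lp_odd ix x (Suc j) \<le> t * lp_even ix x j \<and>
      lp_even ix x (Suc j) \<le> t powr (1 - 1 / 2 ^ Suc j) * (lp_odd ix x j + lp_even ix x j)) \<and>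
    0 \<le> lp_odd ix x (r - 1) \<and> 0 \<le> lp_even ix x (r - 1)"
proof -
  have ball: "(\<forall>j\<in>{1..<r}. Q j) \<longleftrightarrow> (\<forall>j. Suc j < r \<longrightarrow> Q (Suc j))" for Q
    by (metis One_nat_def Suc_le_eq atLeastLessThan_iff gr0_conv_Suc zero_less_Suc)
  have "2 * r - 1 = 2 * (r - 1) + 1" "2 * r = 2 * (r - 1) + 2"
    using r by auto
  moreover have "2 * Suc j - 1 = 2 * j + 1" "2 * Suc j = 2 * j + 2" for j
    by auto
  ultimately show ?thesis
    unfolding lp_feasible_def ball lp_odd_def lp_even_def by (simp add: numeral_2_eq_2)
qed

lemma lp_objective_inner_levels:
  "lp_objective r ix t \<bullet> x = lp_odd ix x 0 + (1 / t) * lp_even ix x 0 +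
    (\<Sum>j = 1..<r. (1 / t ^ (j + 1)) * (lp_odd ix x j + lp_even ix x j))"
  by (simp add: lp_objective_inner lp_odd_def lp_even_def numeral_2_eq_2)

lemma convex_lp_feasible: "convex (lp_feasible r ix t)"
proof (rule convexI)
  fix x y :: "real ^ 'n" and u v :: real
  assume x: "x \<in> lp_feasible r ix t" and y: "y \<in> lp_feasible r ix t" and uv: "0 \<le> u" "0 \<le> v" "u + v = 1"
  have mono: "u * a + v * b \<le> u * c + v * d" if "a \<le> c" "b \<le> d" for a b c d
    using that uv by (intro add_mono mult_left_mono) auto
  have const: "u * c + v * c = c" for c
    using uv(3) by (metis distrib_right mult_1)
  show "u *\<^sub>R x + v *\<^sub>R y \<in> lp_feasible r ix t"
    unfolding lp_feasible_iff lp_odd_even_combine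
  proof (intro conjI allI impI)
    show "u * lp_odd ix x 0 + v * lp_odd ix y 0 \<le> t\<^sup>2"
      using mono[of _ "t\<^sup>2" _ "t\<^sup>2"] x y unfolding lp_feasible_iff const by blast
    show "u * lp_even ix x 0 + v * lp_even ix y 0 \<le> t"
      using mono[of _ t _ t] x y unfolding lp_feasible_iff const by blast
    show "0 \<le> u * lp_odd ix x (r - 1) + v * lp_odd ix y (r - 1)"
      "0 \<le> u * lp_even ix x (r - 1) + v * lp_even ix y (r - 1)"
      using x y uv unfolding lp_feasible_iff by simp_all
  next
    fix j assume j: "Suc j < r"
    have dist: "c * (u * a + v * b) = u * (c * a) + v * (c * b)" for a b c :: real
      by (simp add: algebra_simps)
    show "u * lp_odd ix x (Suc j) + v * lp_odd ix y (Suc j) \<le> t * (u * lp_odd ix x j + v * lp_odd ix y j)"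
      "u * lp_odd ix x (Suc j) + v * lp_odd ix y (Suc j) \<le> t * (u * lp_even ix x j + v * lp_even ix y j)"
      unfolding dist using j x y by (intro mono; simp add: lp_feasible_iff)+
    have "u * lp_odd ix x j + v * lp_odd ix y j + (u * lp_even ix x j + v * lp_even ix y j)
        = u * (lp_odd ix x j + lp_even ix x j) + v * (lp_odd ix y j + lp_even ix y j)"
      by (simp add: algebra_simps)
    then show "u * lp_even ix x (Suc j) + v * lp_even ix y (Suc j) \<le> t powr (1 - 1 / 2 ^ Suc j) *
        (u * lp_odd ix x j + v * lp_odd ix y j + (u * lp_even ix x j + v * lp_even ix y j))"
      using j x y unfolding lp_feasible_iff by (simp only: dist) (intro mono; blast)
  qed
qed

text \<open>Nonnegativity is imposed at the last level only and descends to the earlier ones, since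
  \<open>x\<^sub>2\<^sub>j\<^sub>+\<^sub>3\<close> is bounded above by \<open>t x\<^sub>2\<^sub>j\<^sub>+\<^sub>1\<close> and by \<open>t x\<^sub>2\<^sub>j\<^sub>+\<^sub>2\<close>.\<close>

lemma lp_feasible_nonneg:
  assumes x: "x \<in> lp_feasible r ix t" and t: "1 \<le> t" and j: "j < r"
  shows "0 \<le> lp_odd ix x j \<and> 0 \<le> lp_even ix x j"
proof -
  have "j \<le> r - 1" using j by simp
  then show ?thesis
  proof (induction j rule: inc_induct)
    case base
    then show ?case using x by (simp add: lp_feasible_iff)
  next
    case (step j)
    then have "Suc j < r" by simp
    then have "0 \<le> t * lp_odd ix x j" "0 \<le> t * lp_even ix x j"
      using x step.IH unfolding lp_feasible_iff by (meson order_trans)+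
    then show ?case using t by (simp add: zero_le_mult_iff)
  qed
qed

text \<open>Each step of the recursion loses a factor \<open>2\<close>, because a sum of two entries is replaced by
  twice their maximum.\<close>

lemma lp_feasible_le_scale:
  assumes x: "x \<in> lp_feasible r ix t" and t: "1 \<le> t" and M: "0 < M" and K: "0 \<le> K"
    and start: "lp_odd ix x 0 \<le> K * fst (lp_scale 0 t M)" "lp_even ix x 0 \<le> K * snd (lp_scale 0 t M)"
    and j: "j < r"
  shows "lp_odd ix x j \<le> 2 ^ j * K * fst (lp_scale j t M) \<and> lp_even ix x j \<le> 2 ^ j * K * snd (lp_scale j t M)"
  using j
proof (induction j)
  case 0
  then show ?case using start by simp
next
  case (Suc j)
  let ?p = "fst (lp_scale j t M)" and ?q = "snd (lp_scale j t M)"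
  have IH: "lp_odd ix x j \<le> 2 ^ j * K * ?p" "lp_even ix x j \<le> 2 ^ j * K * ?q"
    using Suc by auto
  have step: "lp_odd ix x (Suc j) \<le> t * lp_odd ix x j" "lp_odd ix x (Suc j) \<le> t * lp_even ix x j"
    "lp_even ix x (Suc j) \<le> t powr (1 - 1 / 2 ^ Suc j) * (lp_odd ix x j + lp_even ix x j)"
    using x Suc.prems by (auto simp: lp_feasible_iff)
  have "lp_odd ix x (Suc j) \<le> t * (2 ^ j * K * ?p)" "lp_odd ix x (Suc j) \<le> t * (2 ^ j * K * ?q)"
    using mult_left_mono[OF IH(1), of t] mult_left_mono[OF IH(2), of t] step t by linarith+
  then have "lp_odd ix x (Suc j) \<le> t * (2 ^ j * K * min ?p ?q)"
    by (simp add: min_def)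
  also have "\<dots> = 2 ^ j * K * (t * min ?p ?q)" by simp
  also have "\<dots> \<le> 2 ^ Suc j * K * (t * min ?p ?q)"
    using K t lp_scale_pos[OF t M, of j] by (intro mult_right_mono) auto
  finally have odd: "lp_odd ix x (Suc j) \<le> 2 ^ Suc j * K * fst (lp_scale (Suc j) t M)" by simp
  have "2 ^ j * K * ?p \<le> 2 ^ j * K * max ?p ?q" "2 ^ j * K * ?q \<le> 2 ^ j * K * max ?p ?q"
    using K by (auto intro!: mult_left_mono)
  then have "lp_odd ix x j + lp_even ix x j \<le> 2 ^ j * K * max ?p ?q + 2 ^ j * K * max ?p ?q"
    using IH by linarith
  also have "\<dots> = 2 ^ Suc j * K * max ?p ?q" by simp
  finally have "lp_odd ix x j + lp_even ix x j \<le> 2 ^ Suc j * K * max ?p ?q" .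
  then have "t powr (1 - 1 / 2 ^ Suc j) * (lp_odd ix x j + lp_even ix x j)
      \<le> t powr (1 - 1 / 2 ^ Suc j) * (2 ^ Suc j * K * max ?p ?q)"
    by (intro mult_left_mono) auto
  then have "lp_even ix x (Suc j) \<le> t powr (1 - 1 / 2 ^ Suc j) * (2 ^ Suc j * K * max ?p ?q)"
    using step(3) by (rule order_trans[rotated])
  then have "lp_even ix x (Suc j) \<le> 2 ^ Suc j * K * snd (lp_scale (Suc j) t M)"
    by (simp add: mult_ac)
  with odd show ?case by blast
qed

lemma compact_lp_feasible:
  assumes t: "1 \<le> t"
  shows "compact (lp_feasible r ix t)"
proof -
  have closed_levels: "closed {x. \<forall>j. Suc j < r \<longrightarrow> Q j x}" if "\<And>j. closed {x. Q j x}" for Q :: "nat \<Rightarrow> real ^ 'n \<Rightarrow> bool"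
    using that by (intro closed_Collect_all closed_Collect_imp) auto
  have "closed {x. lp_odd ix x 0 \<le> t\<^sup>2 \<and> lp_even ix x 0 \<le> t \<and>
    (\<forall>j. Suc j < r \<longrightarrow>
      lp_odd ix x (Suc j) \<le> t * lp_odd ix x j \<and>
      lp_odd ix x (Suc j) \<le> t * lp_even ix x j \<and>
      lp_even ix x (Suc j) \<le> t powr (1 - 1 / 2 ^ Suc j) * (lp_odd ix x j + lp_even ix x j)) \<and>
    0 \<le> lp_odd ix x (r - 1) \<and> 0 \<le> lp_even ix x (r - 1)}"
    by (intro closed_Collect_conj closed_levels closed_Collect_le continuous_intros)
  then have "closed (lp_feasible r ix t)"
    by (simp only: lp_feasible_iff[symmetric] Collect_mem_eq)
  moreover have "bounded (lp_feasible r ix t)"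
  proof (rule bounded_subset[OF bounded_cbox])
    let ?u = "vec_of_levels r ix (\<lambda>j. (2 ^ j * fst (lp_scale j t (t\<^sup>2)), 2 ^ j * snd (lp_scale j t (t\<^sup>2))))"
    show "lp_feasible r ix t \<subseteq> cbox 0 ?u"
    proof
      fix x assume x: "x \<in> lp_feasible r ix t"
      \<comment> \<open>With \<open>M = t\<^sup>2\<close> the first level of the scale is \<open>(t\<^sup>2, t)\<close>, the bounds imposed on \<open>x\<^sub>1\<close> and \<open>x\<^sub>2\<close>.\<close>
      have "1 \<le> t\<^sup>2" using t by (simp add: one_le_power)
      then have "lp_odd ix x 0 \<le> 1 * fst (lp_scale 0 t (t\<^sup>2))" "lp_even ix x 0 \<le> 1 * snd (lp_scale 0 t (t\<^sup>2))"
        using x by (auto simp: lp_feasible_iff)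
      note le = lp_feasible_le_scale[OF x t _ _ this]
      have "(\<forall>i. 0 \<le> x $ i) \<and> (\<forall>i. x $ i \<le> ?u $ i)"
        unfolding all_coordinates_iff unfolding lp_odd_def[symmetric] lp_even_def[symmetric]
        using lp_feasible_nonneg[OF x t] le t by simp
      then show "x \<in> cbox 0 ?u"
        by (simp add: mem_box_cart)
    qed
  qed
  ultimately show ?thesis
    by (simp add: compact_eq_bounded_closed)
qed

lemma zero_in_lp_feasible: "1 \<le> t \<Longrightarrow> 0 \<in> lp_feasible r ix t"
  by (simp add: lp_feasible_iff)

lemma lp_objective_bounds:
  assumes x: "x \<in> lp_feasible r ix t" and t: "1 \<le> t"
  shows "lp_odd ix x 0 \<le> lp_objective r ix t \<bullet> x" "lp_even ix x 0 \<le> t * (lp_objective r ix t \<bullet> x)"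
    "0 \<le> lp_objective r ix t \<bullet> x"
proof -
  have "0 \<le> (\<Sum>j = 1..<r. (1 / t ^ (j + 1)) * (lp_odd ix x j + lp_even ix x j))"
    using lp_feasible_nonneg[OF x t] t by (intro sum_nonneg mult_nonneg_nonneg add_nonneg_nonneg) auto
  moreover have "0 \<le> lp_odd ix x 0" "0 \<le> (1 / t) * lp_even ix x 0"
    using lp_feasible_nonneg[OF x t, of 0] r t by auto
  ultimately show "lp_odd ix x 0 \<le> lp_objective r ix t \<bullet> x" "0 \<le> lp_objective r ix t \<bullet> x"
    and "lp_even ix x 0 \<le> t * (lp_objective r ix t \<bullet> x)"
    unfolding lp_objective_inner_levels using t by (auto simp: field_simps)
qed

text \<open>The box \<open>[l, 2 l]\<close> will be the one inside the polytope; the factors \<open>1 / 4\<^sup>j\<^sup>+\<^sup>1\<close> make room for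
  the constraints between consecutive levels.\<close>

lemma lp_box_levels:
  assumes x: "x \<in> cbox l (2 *\<^sub>R l)"
    and l: "l = vec_of_levels r ix (\<lambda>j. (fst (lp_scale j t M) / 4 ^ Suc j, snd (lp_scale j t M) / 4 ^ Suc j))"
    and j: "j < r"
  shows "fst (lp_scale j t M) / 4 ^ Suc j \<le> lp_odd ix x j \<and> lp_odd ix x j \<le> 2 * (fst (lp_scale j t M) / 4 ^ Suc j)"
    "snd (lp_scale j t M) / 4 ^ Suc j \<le> lp_even ix x j \<and> lp_even ix x j \<le> 2 * (snd (lp_scale j t M) / 4 ^ Suc j)"
proof -
  have bounds: "\<forall>i. l $ i \<le> x $ i \<and> x $ i \<le> (2 *\<^sub>R l) $ i"
    using x by (simp add: mem_box_cart)
  then have "\<forall>j<r. (lp_odd ix l j \<le> lp_odd ix x j \<and> lp_odd ix x j \<le> lp_odd ix (2 *\<^sub>R l) j) \<and>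
      lp_even ix l j \<le> lp_even ix x j \<and> lp_even ix x j \<le> lp_even ix (2 *\<^sub>R l) j"
    unfolding all_coordinates_iff lp_odd_def lp_even_def .
  then show "fst (lp_scale j t M) / 4 ^ Suc j \<le> lp_odd ix x j \<and> lp_odd ix x j \<le> 2 * (fst (lp_scale j t M) / 4 ^ Suc j)"
    "snd (lp_scale j t M) / 4 ^ Suc j \<le> lp_even ix x j \<and> lp_even ix x j \<le> 2 * (snd (lp_scale j t M) / 4 ^ Suc j)"
    unfolding l using j by simp_all
qed

text \<open>Since \<open>2 / 4\<^sup>j\<^sup>+\<^sup>2\<close> is half of \<open>1 / 4\<^sup>j\<^sup>+\<^sup>1\<close>, the constraints hold even between the upper ends of the
  sides at level \<open>j + 1\<close> and the lower ends at level \<open>j\<close>. The maximum in the scale is at most the sum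
  in the constraint.\<close>

lemma lp_box_feasible:
  assumes t: "1 \<le> t" and M: "0 < M"
    and l: "l = vec_of_levels r ix (\<lambda>j. (fst (lp_scale j t M) / 4 ^ Suc j, snd (lp_scale j t M) / 4 ^ Suc j))"
  shows "cbox l (2 *\<^sub>R l) \<subseteq> lp_feasible r ix t"
proof
  fix x assume x: "x \<in> cbox l (2 *\<^sub>R l)"
  note lev = lp_box_levels[OF x l]
  have nonneg: "0 \<le> lp_odd ix x j" "0 \<le> lp_even ix x j" if "j < r" for j
    using lev[OF that] lp_scale_pos[OF t M, of j] by (auto intro: order_trans[rotated])
  show "x \<in> lp_feasible r ix t"
    unfolding lp_feasible_iff
  proof (intro conjI allI impI)
    have "min (t\<^sup>2) M \<le> t\<^sup>2" "t * min 1 M \<le> t * 1"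
      using t by (auto intro!: mult_left_mono)
    moreover have "0 \<le> min (t\<^sup>2) M" "0 \<le> t * min 1 M"
      using t M by auto
    moreover have "lp_odd ix x 0 \<le> min (t\<^sup>2) M / 2" "lp_even ix x 0 \<le> t * min 1 M / 2"
      using lev[of 0] r by simp_all
    ultimately show "lp_odd ix x 0 \<le> t\<^sup>2" "lp_even ix x 0 \<le> t"
      by linarith+
    show "0 \<le> lp_odd ix x (r - 1)" "0 \<le> lp_even ix x (r - 1)"
      using nonneg[of "r - 1"] r by simp_all
  next
    fix j assume j: "Suc j < r"
    then have j': "j < r" by simp
    let ?p = "fst (lp_scale j t M)" and ?q = "snd (lp_scale j t M)"
    let ?T = "t powr (1 - 1 / 2 ^ Suc j)"
    note pos = lp_scale_pos[OF t M, of j]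
    have half: "y / 2 \<le> y" if "0 \<le> y" for y :: real using that by simp
    have "lp_odd ix x (Suc j) \<le> t * (min ?p ?q / 4 ^ Suc j) / 2"
      using lev(1)[OF j] by simp
    also have "\<dots> \<le> t * (min ?p ?q / 4 ^ Suc j)"
      using pos t by (intro half) simp
    finally have le: "lp_odd ix x (Suc j) \<le> t * (min ?p ?q / 4 ^ Suc j)" .
    have "min ?p ?q / 4 ^ Suc j \<le> ?p / 4 ^ Suc j" "min ?p ?q / 4 ^ Suc j \<le> ?q / 4 ^ Suc j"
      by (auto intro!: divide_right_mono)
    then have "min ?p ?q / 4 ^ Suc j \<le> lp_odd ix x j" "min ?p ?q / 4 ^ Suc j \<le> lp_even ix x j"
      using lev[OF j'] by linarith+
    then show "lp_odd ix x (Suc j) \<le> t * lp_odd ix x j" "lp_odd ix x (Suc j) \<le> t * lp_even ix x j"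
      using t by (auto intro!: order_trans[OF le] mult_left_mono)
    have "lp_even ix x (Suc j) \<le> ?T * (max ?p ?q / 4 ^ Suc j) / 2"
      using lev(2)[OF j] by (simp add: mult_ac)
    also have "\<dots> \<le> ?T * (max ?p ?q / 4 ^ Suc j)"
      using pos by (intro half) (simp add: le_max_iff_disj)
    also have "\<dots> \<le> ?T * (lp_odd ix x j + lp_even ix x j)"
    proof (intro mult_left_mono)
      have "max ?p ?q / 4 ^ Suc j = max (?p / 4 ^ Suc j) (?q / 4 ^ Suc j)"
        by (simp add: max_divide_distrib_right)
      then show "max ?p ?q / 4 ^ Suc j \<le> lp_odd ix x j + lp_even ix x j"
        using lev[OF j'] nonneg[OF j'] by linarith
    qed simp
    finally show "lp_even ix x (Suc j) \<le> ?T * (lp_odd ix x j + lp_even ix x j)" .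
  qed
qed

text \<open>By \<open>lp_scale_le\<close> each of the \<open>2 r\<close> terms of the objective is at most \<open>M\<close> on the box.\<close>

lemma lp_box_objective_le:
  assumes t: "1 \<le> t" and M: "0 < M"
    and l: "l = vec_of_levels r ix (\<lambda>j. (fst (lp_scale j t M) / 4 ^ Suc j, snd (lp_scale j t M) / 4 ^ Suc j))"
    and x: "x \<in> cbox l (2 *\<^sub>R l)"
  shows "lp_objective r ix t \<bullet> x \<le> 2 * real r * M"
proof -
  note lev = lp_box_levels[OF x l]
  have le: "lp_odd ix x j \<le> fst (lp_scale j t M)" "lp_even ix x j \<le> snd (lp_scale j t M)" if "j < r" for j
  proof -
    have "2 * (a / 4 ^ Suc j) \<le> a" if "0 < a" for a :: real
    proof -
      have "(4 :: real) ^ 1 \<le> 4 ^ Suc j" by (rule power_increasing) auto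
      then have "(2 :: real) \<le> 4 ^ Suc j" unfolding power_one_right by linarith
      then have "2 * a \<le> 4 ^ Suc j * a" using that by (intro mult_right_mono) auto
      then show ?thesis by (simp add: field_simps)
    qed
    then show "lp_odd ix x j \<le> fst (lp_scale j t M)" "lp_even ix x j \<le> snd (lp_scale j t M)"
      using lev[OF that] lp_scale_pos[OF t M, of j] by (meson order_trans)+
  qed
  have "(1 / t ^ (j + 1)) * (lp_odd ix x j + lp_even ix x j) \<le> 2 * M" if "j < r" for j
  proof -
    have "lp_odd ix x j + lp_even ix x j \<le> t ^ (j + 1) * (2 * M)"
      using le[OF that] lp_scale_le[OF t M, of j] by simp
    then show ?thesis using t by (simp add: field_simps)
  qed
  then have "(\<Sum>j = 1..<r. (1 / t ^ (j + 1)) * (lp_odd ix x j + lp_even ix x j)) \<le> (\<Sum>j = 1..<r. 2 * M)"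
    by (intro sum_mono) auto
  also have "\<dots> = 2 * real (r - 1) * M" by simp
  finally have sum: "(\<Sum>j = 1..<r. (1 / t ^ (j + 1)) * (lp_odd ix x j + lp_even ix x j)) \<le> 2 * real (r - 1) * M" .
  have "lp_odd ix x 0 \<le> M" using le[of 0] r by simp
  moreover have "(1 / t) * lp_even ix x 0 \<le> M"
  proof -
    have "lp_even ix x 0 \<le> t * M" using le(2)[of 0] lp_scale_le[OF t M, of 0] r by simp
    then show ?thesis using t by (simp add: field_simps)
  qed
  moreover have "2 * real (r - 1) * M + 2 * M = 2 * real r * M"
    using r by (simp add: of_nat_diff algebra_simps)
  ultimately show ?thesis
    unfolding lp_objective_inner_levels using sum by linarith
qed

text \<open>The constants depend on \<open>r\<close> and on the dimension only, not on \<open>t\<close> and \<open>M\<close>. The constant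
  \<open>L\<close> of the proof is the level of truncation in \<open>gibbs_mean_bounds\<close>.\<close>

theorem lp_central_path_bounds:
  obtains c C where "0 < c" "0 < C"
    "\<And>t M j. 1 \<le> t \<Longrightarrow> 0 < M \<Longrightarrow> j < r \<Longrightarrow>
      c * fst (lp_scale j t M) \<le> lp_odd ix (entropic_central_path (lp_feasible r ix t) (lp_objective r ix t) M) j \<and>
      lp_odd ix (entropic_central_path (lp_feasible r ix t) (lp_objective r ix t) M) j \<le> C * fst (lp_scale j t M) \<and>
      c * snd (lp_scale j t M) \<le> lp_even ix (entropic_central_path (lp_feasible r ix t) (lp_objective r ix t) M) j \<and>
      lp_even ix (entropic_central_path (lp_feasible r ix t) (lp_objective r ix t) M) j \<le> C * snd (lp_scale j t M)"
proof -
  define L :: real where "L = 2 ^ (CARD('n) + 2)"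
  define C where "C = 2 ^ r * L"
  define \<kappa> :: real where "\<kappa> = 1 / 4 ^ r"
  define c where "c = \<kappa> * exp (- (2 * real r)) / 2 * (\<kappa> / C) ^ CARD('n)"
  have L: "1 \<le> L" unfolding L_def by (rule one_le_power) simp
  have pos: "0 < C" "0 < \<kappa>" "0 < c" using L by (simp_all add: C_def \<kappa>_def c_def)
  show thesis
  proof (rule that[OF pos(3,1)])
    fix t M :: real and j assume t: "1 \<le> t" and M: "0 < M" and j: "j < r"
    let ?P = "lp_feasible r ix t" and ?c = "lp_objective r ix t"
    let ?\<theta> = "- (?c /\<^sub>R M)"
    define a where "a = vec_of_levels r ix (\<lambda>j. lp_scale j t M)"
    define l where "l = vec_of_levels r ix (\<lambda>j. (fst (lp_scale j t M) / 4 ^ Suc j, snd (lp_scale j t M) / 4 ^ Suc j))"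
    have obj: "- (?\<theta> \<bullet> x) = (?c \<bullet> x) / M" for x
      by (simp add: divide_inverse mult.commute)
    note P = compact_lp_feasible[OF t] convex_lp_feasible[of t] zero_in_lp_feasible[OF t]
    have a_pos: "\<forall>i. 0 < a $ i"
      unfolding all_coordinates_iff unfolding lp_odd_def[symmetric] lp_even_def[symmetric]
      using lp_scale_pos[OF t M] by (simp add: a_def)
    have la: "\<forall>i. \<kappa> * a $ i \<le> l $ i"
      unfolding all_coordinates_iff unfolding lp_odd_def[symmetric] lp_even_def[symmetric]
    proof (intro allI impI)
      fix j assume j: "j < r"
      have "\<kappa> * b \<le> b / 4 ^ Suc j" if "0 < b" for b :: real
      proof -
        have "(4 :: real) ^ Suc j \<le> 4 ^ r" using j by (intro power_increasing) auto
        then have "b / 4 ^ r \<le> b / 4 ^ Suc j" using that by (intro divide_left_mono) auto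
        then show ?thesis by (simp add: \<kappa>_def)
      qed
      then show "\<kappa> * lp_odd ix a j \<le> lp_odd ix l j \<and> \<kappa> * lp_even ix a j \<le> lp_even ix l j"
        using lp_scale_pos[OF t M, of j] j by (simp add: a_def l_def del: power_Suc)
    qed
    have nonneg: "\<forall>i. 0 \<le> x $ i" if "x \<in> ?P" for x
      unfolding all_coordinates_iff unfolding lp_odd_def[symmetric] lp_even_def[symmetric]
      using lp_feasible_nonneg[OF that t] by blast
    have upper: "\<forall>i. x $ i \<le> C * a $ i" if x: "x \<in> ?P" and le: "- (?\<theta> \<bullet> x) \<le> L" for x
    proof -
      have obj_le: "?c \<bullet> x \<le> L * M"
        using le M unfolding obj by (simp add: field_simps)
      have "lp_odd ix x 0 \<le> L * M"
        using lp_objective_bounds(1)[OF x t] obj_le by simp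
      moreover have "lp_odd ix x 0 \<le> L * t\<^sup>2"
        using x mult_right_mono[OF L, of "t\<^sup>2"] unfolding lp_feasible_iff by simp
      ultimately have start1: "lp_odd ix x 0 \<le> L * fst (lp_scale 0 t M)"
        by (simp add: min_def)
      have "lp_even ix x 0 \<le> t * (L * M)"
        using lp_objective_bounds(2)[OF x t] obj_le t by (meson mult_left_mono order_trans zero_le_one)
      moreover have "lp_even ix x 0 \<le> L * t"
      proof -
        have "1 * t \<le> L * t" using L t by (intro mult_right_mono) auto
        moreover have "lp_even ix x 0 \<le> t" using x unfolding lp_feasible_iff by blast
        ultimately show ?thesis by linarith
      qed
      ultimately have start2: "lp_even ix x 0 \<le> L * snd (lp_scale 0 t M)"
        by (simp add: min_def mult_ac)
      show ?thesis
        unfolding all_coordinates_iff unfolding lp_odd_def[symmetric] lp_even_def[symmetric]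
      proof (intro allI impI)
        fix j assume j: "j < r"
        have "(2 :: real) ^ j * L \<le> C"
          using j L unfolding C_def by (intro mult_right_mono power_increasing) auto
        then have "2 ^ j * L * fst (lp_scale j t M) \<le> C * fst (lp_scale j t M)"
          "2 ^ j * L * snd (lp_scale j t M) \<le> C * snd (lp_scale j t M)"
          using lp_scale_pos[OF t M, of j] by (auto intro!: mult_right_mono)
        then show "lp_odd ix x j \<le> C * lp_odd ix a j \<and> lp_even ix x j \<le> C * lp_even ix a j"
          using lp_feasible_le_scale[OF x t M _ start1 start2 j] L j by (simp add: a_def)
      qed
    qed
    have box: "cbox l (2 *\<^sub>R l) \<subseteq> ?P"
      by (rule lp_box_feasible[OF t M l_def])
    have box_obj: "- (?\<theta> \<bullet> x) \<le> 2 * real r" if "x \<in> cbox l (2 *\<^sub>R l)" for x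
      using lp_box_objective_le[OF t M l_def that] M unfolding obj by (simp add: field_simps)
    have neg: "?\<theta> \<bullet> x \<le> 0" if "x \<in> ?P" for x
      using lp_objective_bounds(3)[OF that t] M by simp
    note bounds = gibbs_mean_bounds[where P = ?P and \<theta> = ?\<theta> and a = a and l = l and K = C and D = "2 * real r" and \<kappa> = \<kappa>,
        OF P neg nonneg[rule_format] upper[unfolded L_def, rule_format] box box_obj la[rule_format] pos(2,1) a_pos[rule_format]]
    have "entropic_central_path ?P ?c M = gibbs_mean ?P ?\<theta>"
      by (rule entropic_central_path_eq_gibbs_mean[OF P(1,2) bounds(3) M])
    then have "\<forall>i. c * a $ i \<le> entropic_central_path ?P ?c M $ i \<and> entropic_central_path ?P ?c M $ i \<le> C * a $ i"
      using bounds(1,2) by (simp add: c_def)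
    then have "lp_odd ix (c *\<^sub>R a) j \<le> lp_odd ix (entropic_central_path ?P ?c M) j \<and>
        lp_odd ix (entropic_central_path ?P ?c M) j \<le> lp_odd ix (C *\<^sub>R a) j \<and>
        lp_even ix (c *\<^sub>R a) j \<le> lp_even ix (entropic_central_path ?P ?c M) j \<and>
        lp_even ix (entropic_central_path ?P ?c M) j \<le> lp_even ix (C *\<^sub>R a) j"
      by (simp add: lp_odd_def lp_even_def)
    then show "c * fst (lp_scale j t M) \<le> lp_odd ix (entropic_central_path ?P ?c M) j \<and>
      lp_odd ix (entropic_central_path ?P ?c M) j \<le> C * fst (lp_scale j t M) \<and>
      c * snd (lp_scale j t M) \<le> lp_even ix (entropic_central_path ?P ?c M) j \<and>
      lp_even ix (entropic_central_path ?P ?c M) j \<le> C * snd (lp_scale j t M)"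
      using j by (simp add: a_def)
  qed
qed

end

section \<open>The tropical entropic central path of the family\<close>

lemma log_min_real:
  assumes "1 < t" "0 < a" "0 < b"
  shows "log t (min a b) = min (log t a) (log t b)"
  using assms by (simp add: min_def)

lemma log_max_real:
  assumes "1 < t" "0 < a" "0 < b"
  shows "log t (max a b) = max (log t a) (log t b)"
  using assms by (simp add: max_def)

text \<open>Taking \<open>log\<^sub>t\<close> turns products into sums and commutes with minima and maxima, so that the scale
  becomes the tropical recursion.\<close>

lemma log_lp_scale_tendsto:
  assumes \<mu>: "\<mu> \<in> {0..2}" and pos: "\<forall>\<^sub>F t in at_top. 0 < M t"
    and lim: "((\<lambda>t. log t (M t)) \<longlongrightarrow> \<mu>) at_top"
  shows "((\<lambda>t. log t (fst (lp_scale j t (M t)))) \<longlongrightarrow> fst (trop_level j \<mu>)) at_top \<and>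
    ((\<lambda>t. log t (snd (lp_scale j t (M t)))) \<longlongrightarrow> snd (trop_level j \<mu>)) at_top"
proof (induction j)
  case 0
  have "((\<lambda>t. min 2 (log t (M t))) \<longlongrightarrow> min 2 \<mu>) at_top"
    "((\<lambda>t. 1 + min 0 (log t (M t))) \<longlongrightarrow> 1 + min 0 \<mu>) at_top"
    by (intro tendsto_intros lim)+
  moreover have "\<forall>\<^sub>F t in at_top. min 2 (log t (M t)) = log t (fst (lp_scale 0 t (M t)))"
    "\<forall>\<^sub>F t in at_top. 1 + min 0 (log t (M t)) = log t (snd (lp_scale 0 t (M t)))"
    using pos eventually_gt_at_top[of 1]
    by (eventually_elim; simp add: log_min_real log_mult log_nat_power)+
  ultimately have "((\<lambda>t. log t (fst (lp_scale 0 t (M t)))) \<longlongrightarrow> min 2 \<mu>) at_top"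
    "((\<lambda>t. log t (snd (lp_scale 0 t (M t)))) \<longlongrightarrow> 1 + min 0 \<mu>) at_top"
    by (blast intro: Lim_transform_eventually)+
  moreover have "min 2 \<mu> = \<mu>" "1 + min 0 \<mu> = 1" using \<mu> by auto
  ultimately show ?case unfolding trop_level.simps by simp
next
  case (Suc j)
  let ?p = "\<lambda>t. fst (lp_scale j t (M t))" and ?q = "\<lambda>t. snd (lp_scale j t (M t))"
  have "((\<lambda>t. 1 + min (log t (?p t)) (log t (?q t))) \<longlongrightarrow> fst (trop_level (Suc j) \<mu>)) at_top"
    "((\<lambda>t. 1 - 1 / 2 ^ Suc j + max (log t (?p t)) (log t (?q t))) \<longlongrightarrow> snd (trop_level (Suc j) \<mu>)) at_top"
    unfolding trop_level.simps fst_conv snd_conv by (intro tendsto_intros conjunct1[OF Suc] conjunct2[OF Suc])+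
  moreover have "\<forall>\<^sub>F t in at_top. 1 + min (log t (?p t)) (log t (?q t)) = log t (fst (lp_scale (Suc j) t (M t)))"
    "\<forall>\<^sub>F t in at_top. 1 - 1 / 2 ^ Suc j + max (log t (?p t)) (log t (?q t)) = log t (snd (lp_scale (Suc j) t (M t)))"
  proof -
    have "\<forall>\<^sub>F t in at_top. 1 < t \<and> 0 < ?p t \<and> 0 < ?q t"
      using pos eventually_gt_at_top[of 1] by eventually_elim (use lp_scale_pos in auto)
    then have "\<forall>\<^sub>F t in at_top. 1 + min (log t (?p t)) (log t (?q t)) = log t (fst (lp_scale (Suc j) t (M t))) \<and>
      1 - 1 / 2 ^ Suc j + max (log t (?p t)) (log t (?q t)) = log t (snd (lp_scale (Suc j) t (M t)))"
    proof eventually_elim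
      case (elim t)
      then have "0 < min (?p t) (?q t)" "0 < max (?p t) (?q t)" by (auto simp: less_max_iff_disj)
      then have "log t (t * min (?p t) (?q t)) = 1 + log t (min (?p t) (?q t))"
        "log t (t powr (1 - 1 / 2 ^ Suc j) * max (?p t) (?q t)) = (1 - 1 / 2 ^ Suc j) + log t (max (?p t) (?q t))"
        using elim log_mult_pos[of t "min (?p t) (?q t)"] log_mult_pos[of _ "max (?p t) (?q t)"]
        by (simp_all del: power_Suc)
      then show ?case using elim by (simp add: log_min_real log_max_real)
    qed
    then show "\<forall>\<^sub>F t in at_top. 1 + min (log t (?p t)) (log t (?q t)) = log t (fst (lp_scale (Suc j) t (M t)))"
      "\<forall>\<^sub>F t in at_top. 1 - 1 / 2 ^ Suc j + max (log t (?p t)) (log t (?q t)) = log t (snd (lp_scale (Suc j) t (M t)))"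
      by (auto elim: eventually_mono)
  qed
  ultimately show ?case
    by (blast intro: Lim_transform_eventually)
qed

lemma log_tendsto_of_bounded_ratio:
  assumes c: "0 < c" and C: "0 < C"
    and le: "\<forall>\<^sub>F t in at_top. c * a t \<le> x t \<and> x t \<le> C * a t" and a: "\<forall>\<^sub>F t in at_top. 0 < a t"
    and lim: "((\<lambda>t. log t (a t)) \<longlongrightarrow> l) at_top"
  shows "((\<lambda>t. log t (x t)) \<longlongrightarrow> l) at_top"
proof -
  have const: "((\<lambda>t. log t d + log t (a t)) \<longlongrightarrow> l) at_top" for d
  proof -
    have "((\<lambda>t. ln d * inverse (ln t) + log t (a t)) \<longlongrightarrow> ln d * 0 + l) at_top"
      by (intro tendsto_intros tendsto_inverse_0_at_top ln_at_top lim)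
    then show ?thesis by (simp add: log_def divide_inverse)
  qed
  have mid: "\<forall>\<^sub>F t in at_top. log t c + log t (a t) \<le> log t (x t) \<and> log t (x t) \<le> log t C + log t (a t)"
    using le a eventually_gt_at_top[of 1]
  proof eventually_elim
    case (elim t)
    have "0 < c * a t" using elim c by simp
    then have "0 < x t" using elim by linarith
    then have "log t (c * a t) \<le> log t (x t)" "log t (x t) \<le> log t (C * a t)"
      using elim c C by auto
    then show ?case using elim c C by (simp add: log_mult)
  qed
  show ?thesis
    by (rule tendsto_sandwich[OF _ _ const[of c] const[of C]]) (use mid in \<open>auto elim: eventually_mono\<close>)
qed

text \<open>Limits are unique, and some series of valuation \<open>\<mu>\<close> exists, namely the monomial \<open>t\<^sup>\<mu>\<close>.\<close>

lemma tropical_path_eq: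
  assumes "is_tropical_central_point P c \<mu> y"
  shows "tropical_entropic_central_path P c \<mu> = y"
  unfolding tropical_entropic_central_path_def
proof (rule the_equality)
  obtain z where "z \<in> puiseux_pos" "puiseux_val z = ereal \<mu>"
    using puiseux_monomial_exists by blast
  then show "y' = y" if "is_tropical_central_point P c \<mu> y'" for y'
    using assms that unfolding is_tropical_central_point_def
    by (blast intro: tendsto_unique[OF trivial_limit_at_top_linorder])
qed fact

lemma is_tropical_central_point_lp:
  fixes r :: nat and ix :: "nat \<Rightarrow> 'n::finite"
  assumes r: "1 \<le> r" and ix: "bij_betw ix {1..2 * r} UNIV" and \<mu>: "\<mu> \<in> {0..2}"
  shows "is_tropical_central_point (lp_feasible r ix) (lp_objective r ix) \<mu>
    (vec_of_levels r ix (\<lambda>j. trop_level j \<mu>))"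
  unfolding is_tropical_central_point_def
proof (intro ballI impI vec_tendstoI)
  fix m i assume m: "m \<in> puiseux_pos" "puiseux_val m = ereal \<mu>"
  let ?x = "\<lambda>t. entropic_central_path (lp_feasible r ix t) (lp_objective r ix t) (puiseux_eval m t)"
  let ?y = "vec_of_levels r ix (\<lambda>j. trop_level j \<mu>)"
  note pos = puiseux_eval_eventually_pos[OF m]
  note lim = log_lp_scale_tendsto[OF \<mu> pos log_puiseux_eval_tendsto[OF m]]
  obtain c C where c: "0 < c" "0 < C" and bounds: "\<And>t M j. 1 \<le> t \<Longrightarrow> 0 < M \<Longrightarrow> j < r \<Longrightarrow>
      c * fst (lp_scale j t M) \<le> lp_odd ix (entropic_central_path (lp_feasible r ix t) (lp_objective r ix t) M) j \<and>
      lp_odd ix (entropic_central_path (lp_feasible r ix t) (lp_objective r ix t) M) j \<le> C * fst (lp_scale j t M) \<and>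
      c * snd (lp_scale j t M) \<le> lp_even ix (entropic_central_path (lp_feasible r ix t) (lp_objective r ix t) M) j \<and>
      lp_even ix (entropic_central_path (lp_feasible r ix t) (lp_objective r ix t) M) j \<le> C * snd (lp_scale j t M)"
    using lp_central_path_bounds[OF r ix] by blast
  have "((\<lambda>t. log t (lp_odd ix (?x t) j)) \<longlongrightarrow> fst (trop_level j \<mu>)) at_top \<and>
    ((\<lambda>t. log t (lp_even ix (?x t) j)) \<longlongrightarrow> snd (trop_level j \<mu>)) at_top" if j: "j < r" for j
  proof -
    have ev: "\<forall>\<^sub>F t in at_top. 1 \<le> t \<and> 0 < puiseux_eval m t"
      using pos eventually_ge_at_top[of 1] by eventually_elim auto
    have "\<forall>\<^sub>F t in at_top. 0 < fst (lp_scale j t (puiseux_eval m t))"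
      "\<forall>\<^sub>F t in at_top. 0 < snd (lp_scale j t (puiseux_eval m t))"
      using ev by (eventually_elim; use lp_scale_pos in blast)+
    moreover have "\<forall>\<^sub>F t in at_top. c * fst (lp_scale j t (puiseux_eval m t)) \<le> lp_odd ix (?x t) j \<and>
        lp_odd ix (?x t) j \<le> C * fst (lp_scale j t (puiseux_eval m t))"
      "\<forall>\<^sub>F t in at_top. c * snd (lp_scale j t (puiseux_eval m t)) \<le> lp_even ix (?x t) j \<and>
        lp_even ix (?x t) j \<le> C * snd (lp_scale j t (puiseux_eval m t))"
      using ev by (eventually_elim; use bounds[OF _ _ j] in blast)+
    ultimately show ?thesis
      by (intro conjI log_tendsto_of_bounded_ratio[OF c _ _ conjunct1[OF lim[of j]]]
          log_tendsto_of_bounded_ratio[OF c _ _ conjunct2[OF lim[of j]]])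
  qed
  then have "\<forall>i. ((\<lambda>t. log t (?x t $ i)) \<longlongrightarrow> ?y $ i) at_top"
    unfolding all_coordinates_iff[OF r ix] unfolding lp_odd_def[symmetric] lp_even_def[symmetric]
    by (simp add: vec_of_levels_odd[OF r ix] vec_of_levels_even[OF r ix])
  then show "((\<lambda>t. log_vec t (?x t) $ i) \<longlongrightarrow> ?y $ i) at_top"
    by (simp add: log_vec_def)
qed

theorem corollary8:
  fixes r :: nat and ix :: "nat \<Rightarrow> 'n::finite"
  assumes "r \<ge> 1" and "bij_betw ix {1..2 * r} UNIV"
  defines "\<gamma> \<equiv> tropical_entropic_central_path (lp_feasible r ix) (lp_objective r ix)"
  shows "(\<forall>\<mu>\<in>{0..2}. \<exists>y. is_tropical_central_point (lp_feasible r ix) (lp_objective r ix) \<mu> y) \<and>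
    continuous_on {0..2} \<gamma> \<and> piecewise_linear_on {0..2} \<gamma> \<and>
    card (linear_pieces {0..2} \<gamma>) = 2 ^ (r - 1)"
proof -
  let ?N = "2 ^ (r - 1) :: nat" and ?h = "2 / 2 ^ (r - 1) :: real"
  let ?g = "\<lambda>\<mu>. vec_of_levels r ix (\<lambda>j. trop_level j \<mu>)"
  note central = is_tropical_central_point_lp[OF assms(1,2)]
  note coords = all_coordinates_iff[OF assms(1,2)]
  note levels = vec_of_levels_odd[OF assms(1,2)] vec_of_levels_even[OF assms(1,2)]
  have \<gamma>: "\<gamma> \<mu> = ?g \<mu>" if "\<mu> \<in> {0..2}" for \<mu>
    unfolding \<gamma>_def by (rule tropical_path_eq[OF central[OF that]])
  have "\<forall>i. continuous_on {0..2} (\<lambda>\<mu>. ?g \<mu> $ i)"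
    unfolding coords unfolding lp_odd_def[symmetric] lp_even_def[symmetric]
    by (auto simp: levels continuous_on_trop_level cong: continuous_on_cong)
  then have "continuous_on {0..2} (\<lambda>\<mu>. \<chi> i. ?g \<mu> $ i)"
    by (intro continuous_on_vec_lambda) blast
  then have "continuous_on {0..2} ?g" by (simp only: vec_lambda_eta)
  then have cont: "continuous_on {0..2} \<gamma>"
    by (subst continuous_on_cong[OF refl \<gamma>])
  define N h where "N = (2 ^ (r - 1) :: nat)" and "h = (2 / 2 ^ (r - 1) :: real)"
  have h: "0 < h" and N: "1 \<le> N" and range: "{0..real N * h} = {0..2}"
    by (simp_all add: h_def N_def)
  have cell: "grid_cell h k \<subseteq> {0..2}" if "k < N" for k
    using grid_cell_subset[OF h that] by (simp only: range)
  have affine: "affine_on (grid_cell h k) \<gamma>" if k: "k < N" for k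
  proof -
    have "\<forall>i. \<exists>a b. \<forall>x\<in>grid_cell h k. ?g x $ i = a + x * b"
      unfolding coords unfolding lp_odd_def[symmetric] lp_even_def[symmetric]
      using trop_level_affine_on[of k "r - 1"] k by (simp add: levels h_def N_def)
    then obtain a b where "\<And>i x. x \<in> grid_cell h k \<Longrightarrow> ?g x $ i = a i + x * b i"
      by metis
    then have "\<gamma> x = (\<chi> i. a i) + x *\<^sub>R (\<chi> i. b i)" if "x \<in> grid_cell h k" for x
      using \<gamma>[of x] cell[OF k] that by (auto simp: vec_eq_iff)
    then show ?thesis
      unfolding affine_on_def by blast
  qed
  \<comment> \<open>The coordinate \<open>x\<^sub>2\<^sub>r\<^sub>-\<^sub>1\<close> has a kink at every interior knot.\<close>
  have kink: "\<gamma> (real (Suc k) * h + e) - \<gamma> (real (Suc k) * h)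
      \<noteq> \<gamma> (real (Suc k) * h) - \<gamma> (real (Suc k) * h - e)"
    if k: "Suc k < N" and e: "0 < e" "e \<le> h" for k e
  proof
    let ?p = "real (Suc k) * h" and ?u = "\<lambda>x. fst (trop_level (r - 1) x)"
    assume eq: "\<gamma> (?p + e) - \<gamma> ?p = \<gamma> ?p - \<gamma> (?p - e)"
    have "?p + e \<in> grid_cell h (Suc k)" "?p \<in> grid_cell h (Suc k)" "?p - e \<in> grid_cell h k"
      using e by (simp_all add: grid_cell_def algebra_simps)
    then have "?p + e \<in> {0..2}" "?p \<in> {0..2}" "?p - e \<in> {0..2}"
      using cell[OF k] cell[of k] k by (auto simp del: atLeastAtMost_iff)
    then have "?g (?p + e) - ?g ?p = ?g ?p - ?g (?p - e)"
      using eq by (simp only: \<gamma>)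
    then have "lp_odd ix (?g (?p + e) - ?g ?p) (r - 1) = lp_odd ix (?g ?p - ?g (?p - e)) (r - 1)"
      by simp
    moreover have "lp_odd ix (?g x - ?g y) (r - 1) = ?u x - ?u y" for x y
      using levels(1)[of "r - 1"] assms(1) unfolding lp_odd_def vector_minus_component by simp
    ultimately have "?u (?p + e) - ?u ?p = ?u ?p - ?u (?p - e)"
      by (simp only:)
    then show False
      using trop_level_kink[of k "r - 1" e] k e unfolding h_def N_def by blast
  qed
  note pieces = piecewise_linear_on_grid[OF h N affine kink] card_linear_pieces_grid[OF h N affine kink]
  show ?thesis
    using central cont pieces unfolding range N_def[symmetric] by blast
qed

end
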